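(* Let $m\ge1$, let $a_1,\dots,a_m$ be real numbers, $\gamma=\sum_{j=1}^ma_j^2$ and $R_\gamma=\frac12\log_2(1+\gamma)$. In the multiple Gaussian observation model $\mathbf Y_{i,j}=a_j\theta_i+\mathbf W_{i,j}$ ($j=1,\dots,m$, $i=1,\dots,n$) with quadratic distortion and quadratic loss described in the context, the Bayes RD risk at rate $R\ge0$ is $$D^*(R)=\frac1{\gamma+1}+\frac{\gamma}{\gamma+1}\,\eta(R),\qquad \eta(R)=\begin{cases}2^{-2R}, & R\le R_\gamma,\\ 2^{-\frac2m(R-R_\gamma)-2R_\gamma}, & R>R_\gamma.\end{cases}$$
   Context: Model: $\theta^n=(\theta_1,\dots,\theta_n)$ is a standard normal vector in $\mathbb R^n$; $\mathbf W_{i,j}$ are i.i.d. $\mathcal N(0,1)$, independent of $\theta^n$; $\mathbf Y_i=(\mathbf Y_{i,1},\dots,\mathbf Y_{i,m})\in\mathbb R^m$ are the data points, so $\mathbf Y_1\sim\mathcal N(0,\mathbf a\mathbf a^\top+\mathbf I_m)$ with $\mathbf a=(a_1,\dots,a_m)^\top$. The loss is $\frac1n\|\theta^n-\hat\theta^n\|_2^2$. RD-achieving distribution: let $D_y(R)=\min\{\mathbb E\|\mathbf Y_1-\mathbf Z_1\|_2^2: I(\mathbf Y_1;\mathbf Z_1)\le R\}$ (mutual information in bits, minimum over kernels $P_{\mathbf Z_1|\mathbf Y_1}$ from $\mathbb R^m$ to $\mathbb R^m$) be the quadratic distortion-rate function of $\mathbf Y_1$ at rate $R$ bits per vector symbol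 $\mathbf Y_i$, and let $P_{\mathbf Z_1^*|\mathbf Y_1}$ be the kernel attaining it. Across $i=1,\dots,n$ the RD-achieving joint law is the product of copies of $P_{\mathbf Y_1\mathbf Z_1^*}$, with $\theta_i\to\mathbf Y_i\to\mathbf Z_i^*$ a Markov chain; $\mathbf Z^{*n}=(\mathbf Z_1^*,\dots,\mathbf Z_n^* )$. Bayes RD risk: $D^*(R)=\inf_\phi\mathbb E\big[\frac1n\|\theta^n-\phi(\mathbf Z^{*n})\|_2^2\big]$ over measurable $\phi:(\mathbb R^m)^n\to\mathbb R^n$; this equals the minimum mean-squared error of estimating $\theta_1$ from $\mathbf Z_1^*$. *)

theory Defs
  imports "HOL-Probability.Probability"
begin

(* The library's mutual_information is real-valued and takes the junk value 0 if the joint law is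
   not absolutely continuous with respect to the product of the marginals (for instance Y = X
   Gaussian) or if the information density is not integrable. In both cases the mutual information
   of the literature is infinite: the negative part of the information density is always
   integrable. *)
definition (in prob_space) ext_mutual_information ::
    "real \<Rightarrow> 'b measure \<Rightarrow> 'c measure \<Rightarrow> ('a \<Rightarrow> 'b) \<Rightarrow> ('a \<Rightarrow> 'c) \<Rightarrow> ereal" where
  "ext_mutual_information b S T X Y =
     (let P = distr M S X \<Otimes>\<^sub>M distr M T Y;
          Q = distr M (S \<Otimes>\<^sub>M T) (\<lambda>\<omega>. (X \<omega>, Y \<omega>))
      in if absolutely_continuous P Q \<and> integrable Q (entropy_density b P Q)
         then ereal (mutual_information b S T X Y) else \<infinity>)"

type_synonym 'm kernel = "real ^ 'm \<Rightarrow> (real ^ 'm) measure"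

definition kernels :: "'m::finite kernel set" where
  "kernels = borel \<rightarrow>\<^sub>M prob_algebra borel"

definition channel_law ::
    "(real ^ 'm) measure \<Rightarrow> 'm::finite kernel \<Rightarrow> ((real ^ 'm) \<times> (real ^ 'm)) measure" where
  "channel_law P K =
     bind P (\<lambda>y. bind (K y) (\<lambda>z. return (borel \<Otimes>\<^sub>M borel) (y, z)))"

definition channel_rate :: "(real ^ 'm) measure \<Rightarrow> 'm::finite kernel \<Rightarrow> ereal" where
  "channel_rate P K =
     prob_space.ext_mutual_information (channel_law P K) 2 borel borel fst snd"

definition channel_distortion :: "(real ^ 'm) measure \<Rightarrow> 'm::finite kernel \<Rightarrow> ennreal" where
  "channel_distortion P K = (\<integral>\<^sup>+ (y, z). ennreal ((norm (y - z))\<^sup>2) \<partial>channel_law P K)"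

definition distortion_rate :: "(real ^ 'm::finite) measure \<Rightarrow> real \<Rightarrow> ennreal" where
  "distortion_rate P R =
     (INF K \<in> {K \<in> kernels. channel_rate P K \<le> ereal R}. channel_distortion P K)"

definition rd_achieving :: "(real ^ 'm) measure \<Rightarrow> real \<Rightarrow> 'm::finite kernel \<Rightarrow> bool" where
  "rd_achieving P R K \<longleftrightarrow>
     K \<in> kernels \<and> channel_rate P K \<le> ereal R \<and> channel_distortion P K = distortion_rate P R"

definition std_normal :: "real measure" where
  "std_normal = density lborel (\<lambda>x. ennreal (std_normal_density x))"

(* The law of one pair (theta_i, Y_i), where Y_ij = a_j theta_i + W_ij. *)
definition source_obs_law :: "real ^ 'm::finite \<Rightarrow> (real \<times> (real ^ 'm)) measure" where
  "source_obs_law a =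
     distr (std_normal \<Otimes>\<^sub>M (\<Pi>\<^sub>M j\<in>UNIV. std_normal)) (borel \<Otimes>\<^sub>M borel)
       (\<lambda>(t, w). (t, \<chi> j. a $ j * t + w j))"

definition obs_law :: "real ^ 'm::finite \<Rightarrow> (real ^ 'm) measure" where
  "obs_law a = distr (source_obs_law a) borel snd"

(* The law of one triple (theta_i, Y_i, Z_i); the kernel sees only Y_i, so that
   theta_i -> Y_i -> Z_i is a Markov chain. *)
definition source_channel_law ::
    "real ^ 'm::finite \<Rightarrow> 'm kernel \<Rightarrow> (real \<times> (real ^ 'm) \<times> (real ^ 'm)) measure" where
  "source_channel_law a K =
     bind (source_obs_law a)
       (\<lambda>(t, y). bind (K y) (\<lambda>z. return (borel \<Otimes>\<^sub>M borel \<Otimes>\<^sub>M borel) (t, y, z)))"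

(* A sample point x of the n-fold product assigns to each i < n the triple
   x i = (theta_i, Y_i, Z_i). *)
definition bayes_risk :: "nat \<Rightarrow> real ^ 'm::finite \<Rightarrow> 'm kernel \<Rightarrow> ennreal" where
  "bayes_risk n a K =
     (INF \<phi> \<in> (\<Pi>\<^sub>M i\<in>{..<n}. (borel :: (real ^ 'm) measure)) \<rightarrow>\<^sub>M
              (\<Pi>\<^sub>M i\<in>{..<n}. (borel :: real measure)).
        \<integral>\<^sup>+ x. ennreal (1 / real n *
            (\<Sum>i<n. (fst (x i) - \<phi> (\<lambda>k\<in>{..<n}. snd (snd (x k))) i)\<^sup>2))
          \<partial>(\<Pi>\<^sub>M i\<in>{..<n}. source_channel_law a K))"

end

theory Submission
  imports Defs
begin

text \<open>
  After a rotation \<open>T\<close> taking \<open>a\<close> to a multiple of a basis vector, \<open>Y\<close> has independent coordinates of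
  variances \<open>l i\<close>, one equal to \<open>1 + \<gamma>\<close> and the others to 1. The lower bound on the distortion is
  the Donsker--Varadhan inequality applied to the information density of the water-filling channel
  with water level \<open>\<delta>\<close>. It also covers \<open>h(Z)\<close> in place of \<open>Z\<close>, for any measurable \<open>h\<close>.
  Hence for an optimal kernel the coordinate of \<open>Z\<close> along \<open>a\<close> is the best estimator of that
  coordinate of \<open>Y\<close>: otherwise changing only this coordinate of \<open>Z\<close> would beat the bound.
  Perturbing the information density shows that the error of this estimator is exactly \<open>\<delta>\<close>.
  Given \<open>Y\<close>, \<open>\<theta>\<close> is normal with variance \<open>1 / (1 + \<gamma>)\<close> and mean proportional to that coordinate,
  which gives the Bayes risk.
\<close>

section \<open>Channels and mutual information\<close>

text \<open>The theorem speaks of every optimal kernel and no uniqueness is proved, so the error of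
  \<open>Z\<close> cannot be read off an explicit channel. It must be extracted from an arbitrary
  kernel of which only a bound on the rate and the value of the distortion are known. This works
  because the exponential of the information density, integrated over the source, is at most 1 for
  each fixed output point, whatever the law of the output. Inserting \<open>h z\<close> for
  \<open>z\<close> is then free, and so is varying one parameter of the density. The explicit
  water-filling kernel only shows that the bound is attained, which gives existence and the optimal
  value. The level is \<delta> = (1 + \<gamma>) * \<eta>(R). Up to the rate R_\<gamma> it is at
  least 1 and only the direction of \<open>a\<close> carries rate. Beyond it, the remaining R -
  R_\<gamma> bits are shared equally by all m coordinates, hence the factor 2/m in the exponent. The
  risk is 1 / (1 + \<gamma>) + \<gamma> / (1 + \<gamma>)^2 * \<delta>.\<close>

lemma sets_std_normal [measurable_cong, simp]: "sets std_normal = sets borel"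
  by (simp add: std_normal_def)

lemma space_std_normal [simp]: "space std_normal = UNIV"
  by (simp add: std_normal_def)

lemma prob_space_std_normal: "prob_space std_normal"
  unfolding std_normal_def by (rule prob_space_normal_density) simp

lemma prob_space_PiM_std_normal: "prob_space (\<Pi>\<^sub>M j\<in>I. std_normal)"
  by (intro prob_space_PiM prob_space_std_normal)

lemma kernels_prob:
  assumes "K \<in> kernels"
  shows "prob_space (K y)" "sets (K y) = sets borel"
  using measurable_space[OF assms[unfolded kernels_def], of y] by (auto simp: space_prob_algebra)

lemma kernels_measurable: "K \<in> kernels \<Longrightarrow> K \<in> borel \<rightarrow>\<^sub>M prob_algebra borel"
  by (simp add: kernels_def)

context
  fixes P :: "(real ^ 'm::finite) measure" and K :: "'m kernel"
  assumes P: "prob_space P" and sets_P [measurable_cong, simp]: "sets P = sets borel"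
    and K: "K \<in> kernels"
begin

lemma P_in_prob_algebra: "P \<in> space (prob_algebra borel)"
  using P by (simp add: space_prob_algebra)

lemma measurable_channel_kernel:
  "(\<lambda>y. K y \<bind> (\<lambda>z. return (borel \<Otimes>\<^sub>M borel) (y, z))) \<in> borel \<rightarrow>\<^sub>M prob_algebra (borel \<Otimes>\<^sub>M borel)"
proof -
  note [measurable] = kernels_measurable[OF K]
  show ?thesis by measurable
qed

lemma prob_space_channel_law: "prob_space (channel_law P K)"
  unfolding channel_law_def by (rule prob_space_bind'[OF P_in_prob_algebra measurable_channel_kernel])

lemma sets_channel_law: "sets (channel_law P K) = sets (borel \<Otimes>\<^sub>M borel)"
  unfolding channel_law_def by (rule sets_bind'[OF P_in_prob_algebra measurable_channel_kernel])

lemma nn_integral_channel_law: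
  assumes [measurable]: "F \<in> borel_measurable (borel \<Otimes>\<^sub>M borel)"
  shows "(\<integral>\<^sup>+ x. F x \<partial>channel_law P K) = (\<integral>\<^sup>+ y. \<integral>\<^sup>+ z. F (y, z) \<partial>K y \<partial>P)"
proof -
  note [measurable] = kernels_measurable[OF K] measurable_channel_kernel
  have "(\<integral>\<^sup>+ x. F x \<partial>channel_law P K) =
      (\<integral>\<^sup>+ y. \<integral>\<^sup>+ x. F x \<partial>(K y \<bind> (\<lambda>z. return (borel \<Otimes>\<^sub>M borel) (y, z))) \<partial>P)"
    unfolding channel_law_def
    by (rule nn_integral_bind[where B="borel \<Otimes>\<^sub>M borel"])
       (auto intro!: measurable_prob_algebraD simp: measurable_cong_sets[OF sets_P refl])
  also have "\<dots> = (\<integral>\<^sup>+ y. \<integral>\<^sup>+ z. F (y, z) \<partial>K y \<partial>P)"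
  proof (rule nn_integral_cong)
    fix y
    have [simp, measurable_cong]: "sets (K y) = sets borel" using kernels_prob[OF K] by simp
    have "(\<integral>\<^sup>+ x. F x \<partial>(K y \<bind> (\<lambda>z. return (borel \<Otimes>\<^sub>M borel) (y, z)))) =
        (\<integral>\<^sup>+ z. \<integral>\<^sup>+ x. F x \<partial>return (borel \<Otimes>\<^sub>M borel) (y, z) \<partial>K y)"
      by (rule nn_integral_bind[where B="borel \<Otimes>\<^sub>M borel"]) (auto intro!: measurable_prob_algebraD)
    also have "\<dots> = (\<integral>\<^sup>+ z. F (y, z) \<partial>K y)"
      by (intro nn_integral_cong nn_integral_return) (auto simp: space_pair_measure)
    finally show "(\<integral>\<^sup>+ x. F x \<partial>(K y \<bind> (\<lambda>z. return (borel \<Otimes>\<^sub>M borel) (y, z)))) = \<dots>" .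
  qed
  finally show ?thesis .
qed

declare sets_channel_law [simp, measurable_cong]

lemma distr_channel_law_fst: "distr (channel_law P K) borel fst = P"
proof (rule measure_eqI)
  fix A assume "A \<in> sets (distr (channel_law P K) borel fst)"
  then have A [measurable]: "A \<in> sets borel" by simp
  have "emeasure (distr (channel_law P K) borel fst) A =
      (\<integral>\<^sup>+ y. indicator A y \<partial>distr (channel_law P K) borel fst)" by simp
  also have "\<dots> = (\<integral>\<^sup>+ x. indicator A (fst x) \<partial>channel_law P K)"
    by (rule nn_integral_distr) auto
  also have "\<dots> = (\<integral>\<^sup>+ y. \<integral>\<^sup>+ z. indicator A y \<partial>K y \<partial>P)"
    by (subst nn_integral_channel_law) auto
  also have "\<dots> = (\<integral>\<^sup>+ y. indicator A y \<partial>P)"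
    by (intro nn_integral_cong) (simp add: prob_space.emeasure_space_1[OF kernels_prob(1)[OF K]])
  finally show "emeasure (distr (channel_law P K) borel fst) A = emeasure P A" by simp
qed simp

text \<open>A finite bound excludes the value \<infinity>, so both side conditions in
  \<open>ext_mutual_information\<close> hold. They are what the Donsker-Varadhan inequality below
  asks for.\<close>

lemma channel_rate_finite:
  assumes "channel_rate P K \<le> ereal R"
  defines "PP \<equiv> P \<Otimes>\<^sub>M distr (channel_law P K) borel snd"
  shows "absolutely_continuous PP (channel_law P K)"
    and "integrable (channel_law P K) (entropy_density 2 PP (channel_law P K))"
    and "KL_divergence 2 PP (channel_law P K) \<le> R"
proof -
  interpret prob_space "channel_law P K" by (rule prob_space_channel_law)
  have [simp]: "distr (channel_law P K) (borel \<Otimes>\<^sub>M borel) (\<lambda>\<omega>. \<omega>) = channel_law P K"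
    by (rule distr_id2) simp
  show "absolutely_continuous PP (channel_law P K)"
    and "integrable (channel_law P K) (entropy_density 2 PP (channel_law P K))"
    and "KL_divergence 2 PP (channel_law P K) \<le> R"
    using assms(1)
    by (auto simp: channel_rate_def ext_mutual_information_def mutual_information_def PP_def Let_def
        distr_channel_law_fst split: if_splits)
qed

declare sets_channel_law [simp del, measurable_cong del]

end

text \<open>Integrate \<open>ln q \<le> q - 1\<close> under \<open>Q\<close>, where \<open>q\<close>
  is \<open>g\<close> divided by the density of \<open>Q\<close>; the mean of \<open>q\<close> is at
  most the \<open>P\<close>-integral of \<open>g\<close>. Asking only for an integral at most 1 lets
  in coordinates below the water level, where the tilted source law loses mass.\<close>

lemma Donsker_Varadhan_le_KL_divergence:
  fixes g :: "'a \<Rightarrow> real"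
  assumes P: "prob_space P" and Q: "prob_space Q" and sQ [measurable_cong]: "sets Q = sets P"
    and ac: "absolutely_continuous P Q"
    and int: "integrable Q (entropy_density b P Q)" and b: "1 < b"
    and g [measurable]: "g \<in> borel_measurable P" and g_pos: "\<And>x. 0 < g x"
    and g_le: "(\<integral>\<^sup>+ x. ennreal (g x) \<partial>P) \<le> 1"
    and int_g: "integrable Q (\<lambda>x. log b (g x))"
  shows "(\<integral>x. log b (g x) \<partial>Q) \<le> KL_divergence b P Q"
proof -
  interpret P: prob_space P by fact
  interpret Q: prob_space Q by fact
  define D where "D = RN_deriv P Q"
  have [measurable]: "D \<in> borel_measurable P" unfolding D_def by simp
  have QD: "Q = density P D"
    unfolding D_def using P.density_RN_deriv[OF ac sQ] by simp
  have D_fin: "AE x in P. D x \<noteq> \<infinity>"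
    unfolding D_def using Q.sigma_finite_measure_axioms sQ ac
    by (intro P.RN_deriv_finite) auto
  \<comment> \<open>\<open>Q\<close> does not charge the set \<open>D = 0\<close>, so the values of
    \<open>q\<close> obtained there by division by 0 do no harm.\<close>
  have AEQ: "AE x in Q. 0 < D x \<and> D x \<noteq> \<infinity>"
    unfolding QD using D_fin by (subst AE_density) (auto simp: zero_less_iff_neq_zero)
  define q where "q x = g x / enn2real (D x)" for x
  have [measurable]: "q \<in> borel_measurable P" unfolding q_def by measurable
  have q0: "0 \<le> q x" for x using g_pos[of x] by (simp add: q_def)
  have "(\<integral>\<^sup>+ x. ennreal (q x) \<partial>Q) = (\<integral>\<^sup>+ x. D x * ennreal (q x) \<partial>P)"
    unfolding QD by (subst nn_integral_density) auto
  \<comment> \<open>Only an inequality: where \<open>D = 0\<close> the left integrand vanishes while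
    \<open>g\<close> is positive.\<close>
  also have "\<dots> \<le> (\<integral>\<^sup>+ x. ennreal (g x) \<partial>P)"
  proof (rule nn_integral_mono_AE, use D_fin in eventually_elim)
    fix x assume "D x \<noteq> \<infinity>"
    then obtain d where d: "D x = ennreal d" "0 \<le> d" by (cases "D x") auto
    then show "D x * ennreal (q x) \<le> ennreal (g x)"
      using g_pos[of x] q0[of x] by (auto simp: q_def ennreal_mult[symmetric] less_imp_le)
  qed
  finally have q_le: "(\<integral>\<^sup>+ x. ennreal (q x) \<partial>Q) \<le> 1" using g_le by simp
  have int_q: "integrable Q q"
    using q_le q0 by (intro integrableI_nonneg) (auto simp: less_top[symmetric] top_unique)
  have q_le': "(\<integral>x. q x \<partial>Q) \<le> 1"
    using q_le nn_integral_eq_integral[OF int_q] q0 by (simp add: ennreal_le_1)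
  have "(\<integral>x. log b (g x) \<partial>Q) - KL_divergence b P Q =
      (\<integral>x. log b (g x) - entropy_density b P Q x \<partial>Q)"
    unfolding KL_divergence_def using int int_g by simp
  also have "\<dots> \<le> (\<integral>x. (q x - 1) / ln b \<partial>Q)"
  proof (rule integral_mono_AE)
    show "AE x in Q. log b (g x) - entropy_density b P Q x \<le> (q x - 1) / ln b"
      using AEQ
    proof eventually_elim
      fix x assume "0 < D x \<and> D x \<noteq> \<infinity>"
      then have d: "0 < enn2real (D x)"
        by (simp add: enn2real_positive_iff less_top)
      have "ln (q x) \<le> q x - 1"
        using d g_pos[of x] by (intro ln_le_minus_one) (simp add: q_def)
      moreover have "ln (q x) = ln (g x) - ln (enn2real (D x))"
        using d g_pos[of x] by (simp add: q_def ln_div)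
      ultimately show "log b (g x) - entropy_density b P Q x \<le> (q x - 1) / ln b"
        using b by (simp add: entropy_density_def D_def log_def diff_divide_distrib[symmetric] divide_right_mono)
    qed
  qed (use int int_g int_q in auto)
  also have "\<dots> = ((\<integral>x. q x \<partial>Q) - 1) / ln b"
    using int_q by (simp add: Q.prob_space)
  also have "\<dots> \<le> 0" using q_le' b by (simp add: divide_le_0_iff)
  finally show ?thesis by simp
qed

section \<open>Gaussian laws\<close>

lemma borel_measurable_vec_lambda [measurable (raw)]:
  fixes f :: "'i::finite \<Rightarrow> 'a \<Rightarrow> real"
  assumes "\<And>i. f i \<in> borel_measurable M"
  shows "(\<lambda>x. \<chi> i. f i x) \<in> borel_measurable M"
  using assms by (subst borel_measurable_euclidean_space) (auto simp: Basis_vec_def inner_axis)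

lemma borel_measurable_vec_nth [measurable (raw)]:
  fixes f :: "'a \<Rightarrow> real ^ 'i::finite"
  shows "f \<in> borel_measurable M \<Longrightarrow> (\<lambda>x. f x $ i) \<in> borel_measurable M"
  by (rule measurable_compose[OF _ borel_measurable_nth])

lemma borel_measurable_orthogonal:
  fixes T :: "'a::euclidean_space \<Rightarrow> 'a"
  assumes "orthogonal_transformation T"
  shows "T \<in> borel_measurable borel"
  using orthogonal_transformation_linear[OF assms]
  by (intro borel_measurable_continuous_onI linear_continuous_on) (simp add: linear_conv_bounded_linear)

section \<open>Normal integrals in one dimension\<close>

lemma distr_std_normal_affine:
  assumes "0 < \<sigma>"
  shows "distr std_normal borel (\<lambda>w. \<mu> + \<sigma> * w) = density lborel (normal_density \<mu> \<sigma>)"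
proof -
  interpret prob_space std_normal by (rule prob_space_std_normal)
  have "distributed std_normal lborel (\<lambda>w. w) (normal_density 0 1)"
    unfolding distributed_def std_normal_def by (auto simp: distr_id2)
  from normal_density_affine[OF this, of \<sigma> \<mu>] assms
  have "distr std_normal lborel (\<lambda>w. \<mu> + \<sigma> * w) = density lborel (normal_density \<mu> \<sigma>)"
    by (simp add: distributed_def)
  then show ?thesis by (metis distr_cong sets_lborel)
qed

lemma nn_integral_std_normal_affine:
  assumes "0 < \<sigma>" and [measurable]: "F \<in> borel_measurable borel"
  shows "(\<integral>\<^sup>+ w. F (\<mu> + \<sigma> * w) \<partial>std_normal) = (\<integral>\<^sup>+ x. ennreal (normal_density \<mu> \<sigma> x) * F x \<partial>lborel)"
proof -
  have "(\<integral>\<^sup>+ w. F (\<mu> + \<sigma> * w) \<partial>std_normal) = (\<integral>\<^sup>+ x. F x \<partial>distr std_normal borel (\<lambda>w. \<mu> + \<sigma> * w))"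
    by (subst nn_integral_distr) auto
  also have "\<dots> = (\<integral>\<^sup>+ x. ennreal (normal_density \<mu> \<sigma> x) * F x \<partial>lborel)"
    by (simp add: distr_std_normal_affine[OF assms(1)] nn_integral_density)
  finally show ?thesis .
qed

lemma nn_integral_std_normal_scale:
  assumes "0 < \<sigma>" and "F \<in> borel_measurable borel"
  shows "(\<integral>\<^sup>+ w. F (\<sigma> * w) \<partial>std_normal) = (\<integral>\<^sup>+ x. ennreal (normal_density 0 \<sigma> x) * F x \<partial>lborel)"
  using nn_integral_std_normal_affine[OF assms, of 0] by simp

lemma nn_integral_normal_density:
  "0 < \<sigma> \<Longrightarrow> (\<integral>\<^sup>+ x. ennreal (normal_density \<mu> \<sigma> x) \<partial>lborel) = 1"
  by (subst nn_integral_eq_integral) auto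

lemma nn_integral_normal_density_variance:
  assumes "0 < \<sigma>"
  shows "(\<integral>\<^sup>+ x. ennreal (normal_density \<mu> \<sigma> x * (x - \<mu>)\<^sup>2) \<partial>lborel) = ennreal (\<sigma>\<^sup>2)"
proof -
  have "has_bochner_integral lborel (\<lambda>x. normal_density \<mu> \<sigma> x * (x - \<mu>)\<^sup>2) (\<sigma>\<^sup>2)"
    using normal_moment_even[OF assms, of \<mu> 1] by (simp add: field_simps numeral_2_eq_2)
  then show ?thesis
    by (subst nn_integral_eq_integral) (auto simp: has_bochner_integral_iff)
qed

lemma nn_integral_std_normal_affine_square:
  "(\<integral>\<^sup>+ w. ennreal ((\<sigma> * w + b)\<^sup>2) \<partial>std_normal) = ennreal (\<sigma>\<^sup>2 + b\<^sup>2)"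
proof -
  have 2: "has_bochner_integral lborel (\<lambda>x. std_normal_density x * x\<^sup>2) 1"
    using std_normal_moment_even[of 1] by (simp add: numeral_2_eq_2)
  have 1: "has_bochner_integral lborel (\<lambda>x. std_normal_density x * x) 0"
    using std_normal_moment_odd[of 0] by simp
  have 0: "has_bochner_integral lborel (\<lambda>x. std_normal_density x) 1"
    by (simp add: has_bochner_integral_iff)
  have "has_bochner_integral lborel (\<lambda>x. \<sigma>\<^sup>2 * (std_normal_density x * x\<^sup>2) +
      (2 * \<sigma> * b) * (std_normal_density x * x) + b\<^sup>2 * std_normal_density x)
      (\<sigma>\<^sup>2 * 1 + (2 * \<sigma> * b) * 0 + b\<^sup>2 * 1)"
    by (intro has_bochner_integral_add has_bochner_integral_mult_right 0 1 2)
  also have "(\<lambda>x. \<sigma>\<^sup>2 * (std_normal_density x * x\<^sup>2) +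
      (2 * \<sigma> * b) * (std_normal_density x * x) + b\<^sup>2 * std_normal_density x) =
      (\<lambda>x. std_normal_density x * (\<sigma> * x + b)\<^sup>2)"
    by (auto simp: algebra_simps power2_eq_square)
  finally have *: "has_bochner_integral lborel (\<lambda>x. std_normal_density x * (\<sigma> * x + b)\<^sup>2) (\<sigma>\<^sup>2 + b\<^sup>2)"
    by simp
  have "(\<integral>\<^sup>+ w. ennreal ((\<sigma> * w + b)\<^sup>2) \<partial>std_normal) =
      (\<integral>\<^sup>+ x. ennreal (std_normal_density x * (\<sigma> * x + b)\<^sup>2) \<partial>lborel)"
    unfolding std_normal_def by (subst nn_integral_density) (auto simp: ennreal_mult)
  also have "\<dots> = ennreal (\<sigma>\<^sup>2 + b\<^sup>2)"
    using * by (subst nn_integral_eq_integral) (auto simp: has_bochner_integral_iff)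
  finally show ?thesis .
qed

text \<open>One coordinate of the information density, in nats. If \<open>e\<close> is the variance of the source
  coordinate, it is the log of the ratio of the densities of \<open>N(z, d)\<close> and \<open>N(0, e)\<close>; the choice
  \<open>e = d\<close> is for coordinates below the water level, which get rate 0.\<close>

definition info_term :: "real \<Rightarrow> real \<Rightarrow> real \<Rightarrow> real \<Rightarrow> real" where
  "info_term e d x z = ln (e / d) / 2 - (x - z)\<^sup>2 / (2 * d) + x\<^sup>2 / (2 * e)"

lemma borel_measurable_info_term [measurable (raw)]:
  assumes [measurable]: "f \<in> borel_measurable M" "g \<in> borel_measurable M"
  shows "(\<lambda>x. info_term e d (f x) (g x)) \<in> borel_measurable M"
  unfolding info_term_def by measurable

lemma exp_half_ln: "0 < (x::real) \<Longrightarrow> exp (ln x / 2) = sqrt x"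
  by (simp add: ln_sqrt[symmetric])

text \<open>With \<open>e = l\<close> the last term of \<open>info_term\<close> cancels the exponent
  of the source density. What is left is the backward test channel: the source is the output plus
  independent noise of variance \<open>d\<close>.\<close>

lemma normal_density_tilt_active:
  assumes "0 < l" "0 < d"
  shows "normal_density 0 (sqrt l) x * exp (info_term l d x z) = normal_density z (sqrt d) x"
proof -
  have "- (x - 0)\<^sup>2 / (2 * l) + info_term l d x z = ln (l / d) / 2 + - (x - z)\<^sup>2 / (2 * d)"
    by (simp add: info_term_def)
  then have tilt: "exp (- (x - 0)\<^sup>2 / (2 * l)) * exp (info_term l d x z) = sqrt (l / d) * exp (- (x - z)\<^sup>2 / (2 * d))"
    using assms by (simp only: mult_exp_exp exp_add exp_half_ln divide_pos_pos)
  have scale: "1 / sqrt (2 * pi * l) * sqrt (l / d) = 1 / sqrt (2 * pi * d)"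
    using assms by (simp add: real_sqrt_mult real_sqrt_divide)
  have "normal_density 0 (sqrt l) x * exp (info_term l d x z) =
      1 / sqrt (2 * pi * l) * (exp (- (x - 0)\<^sup>2 / (2 * l)) * exp (info_term l d x z))"
    using assms by (simp add: normal_density_def)
  also have "\<dots> = (1 / sqrt (2 * pi * l) * sqrt (l / d)) * exp (- (x - z)\<^sup>2 / (2 * d))"
    unfolding tilt by (simp only: mult.assoc)
  also have "\<dots> = normal_density z (sqrt d) x"
    unfolding scale using assms by (simp add: normal_density_def)
  finally show ?thesis .
qed

text \<open>With \<open>e = d\<close> the squares of \<open>x\<close> in \<open>info_term\<close>
  cancel, so the tilt is linear in \<open>x\<close> and merely shifts the mean, by completing the
  square. The prefactor is at most 1 exactly when \<open>l \<le> d\<close> or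
  \<open>z = 0\<close>.\<close>

lemma normal_density_tilt_inactive:
  assumes "0 < l" "0 < d"
  shows "normal_density 0 (sqrt l) x * exp (info_term d d x z) =
    exp (l * z\<^sup>2 / (2 * d\<^sup>2) - z\<^sup>2 / (2 * d)) * normal_density (l * z / d) (sqrt l) x"
proof -
  have "- (x - 0)\<^sup>2 / (2 * l) + info_term d d x z =
      (l * z\<^sup>2 / (2 * d\<^sup>2) - z\<^sup>2 / (2 * d)) + - (x - l * z / d)\<^sup>2 / (2 * l)"
    using assms unfolding info_term_def by (simp add: field_simps power2_eq_square)
  then have "exp (- (x - 0)\<^sup>2 / (2 * l)) * exp (info_term d d x z) =
      exp (l * z\<^sup>2 / (2 * d\<^sup>2) - z\<^sup>2 / (2 * d)) * exp (- (x - l * z / d)\<^sup>2 / (2 * l))"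
    by (simp only: mult_exp_exp)
  then show ?thesis
    using assms unfolding normal_density_def by simp
qed

lemma nn_integral_info_active:
  assumes "0 < l" "0 < d"
  shows "(\<integral>\<^sup>+ w. ennreal (exp (info_term l d (sqrt l * w) z)) \<partial>std_normal) = 1"
    and "(\<integral>\<^sup>+ w. ennreal (exp (info_term l d (sqrt l * w) z)) * ennreal ((sqrt l * w - z)\<^sup>2) \<partial>std_normal) = ennreal d"
proof -
  have "(\<integral>\<^sup>+ w. ennreal (exp (info_term l d (sqrt l * w) z)) \<partial>std_normal) =
      (\<integral>\<^sup>+ x. ennreal (normal_density z (sqrt d) x) \<partial>lborel)"
    using assms
    by (subst nn_integral_std_normal_scale[where F="\<lambda>x. ennreal (exp (info_term l d x z))"])
       (auto simp: ennreal_mult[symmetric] normal_density_tilt_active)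
  also have "\<dots> = 1" using assms by (simp add: nn_integral_normal_density)
  finally show "(\<integral>\<^sup>+ w. ennreal (exp (info_term l d (sqrt l * w) z)) \<partial>std_normal) = 1" .
  have "(\<integral>\<^sup>+ w. ennreal (exp (info_term l d (sqrt l * w) z)) * ennreal ((sqrt l * w - z)\<^sup>2) \<partial>std_normal) =
      (\<integral>\<^sup>+ x. ennreal (normal_density z (sqrt d) x * (x - z)\<^sup>2) \<partial>lborel)"
    using assms
    by (subst nn_integral_std_normal_scale[where F="\<lambda>x. ennreal (exp (info_term l d x z)) * ennreal ((x - z)\<^sup>2)"])
       (auto simp: ennreal_mult[symmetric] normal_density_tilt_active mult.assoc[symmetric])
  also have "\<dots> = ennreal d" using assms by (simp add: nn_integral_normal_density_variance)
  finally show "(\<integral>\<^sup>+ w. ennreal (exp (info_term l d (sqrt l * w) z)) * ennreal ((sqrt l * w - z)\<^sup>2) \<partial>std_normal) = ennreal d" .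
qed

lemma nn_integral_info_inactive:
  assumes "0 < l" "l \<le> d"
  shows "(\<integral>\<^sup>+ w. ennreal (exp (info_term d d (sqrt l * w) z)) \<partial>std_normal) \<le> 1"
proof -
  have d: "0 < d" using assms by simp
  let ?c = "l * z\<^sup>2 / (2 * d\<^sup>2) - z\<^sup>2 / (2 * d)"
  have "(\<integral>\<^sup>+ w. ennreal (exp (info_term d d (sqrt l * w) z)) \<partial>std_normal) =
      (\<integral>\<^sup>+ x. ennreal (exp ?c) * ennreal (normal_density (l * z / d) (sqrt l) x) \<partial>lborel)"
    using assms d
    by (subst nn_integral_std_normal_scale[where F="\<lambda>x. ennreal (exp (info_term d d x z))"])
       (auto simp: ennreal_mult[symmetric] normal_density_tilt_inactive)
  also have "\<dots> = ennreal (exp ?c)"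
    using assms by (simp add: nn_integral_cmult nn_integral_normal_density)
  also have "\<dots> \<le> 1"
  proof -
    have "l * z\<^sup>2 / (2 * d\<^sup>2) \<le> d * z\<^sup>2 / (2 * d\<^sup>2)"
      using assms by (intro divide_right_mono mult_right_mono) auto
    then have "?c \<le> 0" using d by (simp add: power2_eq_square)
    then show ?thesis by (simp add: ennreal_le_1)
  qed
  finally show ?thesis .
qed

text \<open>Multiplied by the source density at \<open>x\<close>, the integral becomes the
  convolution of N(0, d) and N(0, l - d), which is N(0, l); the positive source density then
  cancels. This normalises the forward channel.\<close>

lemma nn_integral_info_backward:
  assumes "0 < d" "d < l"
  shows "(\<integral>\<^sup>+ w. ennreal (exp (info_term l d x (sqrt (l - d) * w))) \<partial>std_normal) = 1"
proof -
  have l: "0 < l" "0 < sqrt (l - d)" "0 < sqrt d" using assms by auto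
  have "ennreal (normal_density 0 (sqrt l) x) * (\<integral>\<^sup>+ w. ennreal (exp (info_term l d x (sqrt (l - d) * w))) \<partial>std_normal)
     = (\<integral>\<^sup>+ z. ennreal (normal_density 0 (sqrt d) (x - z) * normal_density 0 (sqrt (l - d)) z) \<partial>lborel)"
  proof -
    have n: "normal_density 0 (sqrt d) (x - z) = normal_density 0 (sqrt l) x * exp (info_term l d x z)" for z
      unfolding normal_density_tilt_active[OF l(1) assms(1)] by (simp add: normal_density_def)
    have t: "ennreal (normal_density 0 (sqrt l) x) *
          (ennreal (normal_density 0 (sqrt (l - d)) z) * ennreal (exp (info_term l d x z))) =
        ennreal (normal_density 0 (sqrt d) (x - z) * normal_density 0 (sqrt (l - d)) z)" for z
      by (simp add: n ennreal_mult[symmetric] ac_simps)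
    show ?thesis
      using l
      by (subst nn_integral_std_normal_scale[where F="\<lambda>z. ennreal (exp (info_term l d x z))"])
         (simp_all add: nn_integral_cmult[symmetric] t)
  qed
  also have "\<dots> = ennreal (normal_density 0 (sqrt l) x)"
    using fun_cong[OF conv_normal_density_zero_mean[OF l(3,2)], of x] assms by simp
  finally have "ennreal (normal_density 0 (sqrt l) x) *
      (\<integral>\<^sup>+ w. ennreal (exp (info_term l d x (sqrt (l - d) * w))) \<partial>std_normal) =
      ennreal (normal_density 0 (sqrt l) x) * 1"
    by simp
  then show ?thesis
    unfolding ennreal_mult_cancel_left using l(1) normal_density_pos[of "sqrt l" 0 x] by auto
qed

lemma info_term_zero [simp]: "0 < d \<Longrightarrow> info_term d d x 0 = 0"
  by (simp add: info_term_def)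

text \<open>The rotated coordinates \<open>T y $ i\<close> are independent normal with standard
  deviations \<open>\<sigma> i\<close>. An image measure, unlike a density, allows
  \<open>\<sigma> i = 0\<close>, which occurs for the outputs of coordinates that get no
  rate.\<close>

definition gauss_law :: "(real ^ 'm \<Rightarrow> real ^ 'm) \<Rightarrow> ('m \<Rightarrow> real) \<Rightarrow> (real ^ 'm::finite) measure" where
  "gauss_law T \<sigma> = distr (\<Pi>\<^sub>M j\<in>UNIV. std_normal) borel (\<lambda>v. inv T (\<chi> i. \<sigma> i * v i))"

lemma sets_gauss_law [simp, measurable_cong]: "sets (gauss_law T \<sigma>) = sets borel"
  by (simp add: gauss_law_def)

lemma space_gauss_law [simp]: "space (gauss_law T \<sigma>) = UNIV"
  by (simp add: gauss_law_def)

context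
  fixes T :: "real ^ 'm::finite \<Rightarrow> real ^ 'm"
  assumes T: "orthogonal_transformation T"
begin

lemma T_inv [simp]: "T (inv T x) = x" "inv T (T x) = x"
  using orthogonal_transformation_bij[OF T] by (auto simp: bij_is_inj bij_is_surj surj_f_inv_f)

lemma borel_measurable_T: "T \<in> borel_measurable borel" "inv T \<in> borel_measurable borel"
  using T by (auto intro!: borel_measurable_orthogonal orthogonal_transformation_inv)

lemma measurable_gauss_map:
  "(\<lambda>v. inv T (\<chi> i. \<sigma> i * v i)) \<in> (\<Pi>\<^sub>M j\<in>UNIV. std_normal) \<rightarrow>\<^sub>M borel"
proof -
  note [measurable] = borel_measurable_T
  show ?thesis by measurable
qed

lemma prob_space_gauss_law: "prob_space (gauss_law T \<sigma>)"
  unfolding gauss_law_def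
  by (intro prob_space.prob_space_distr prob_space_PiM_std_normal measurable_gauss_map)

lemma nn_integral_gauss_law:
  "F \<in> borel_measurable borel \<Longrightarrow>
    (\<integral>\<^sup>+ y. F y \<partial>gauss_law T \<sigma>) = (\<integral>\<^sup>+ v. F (inv T (\<chi> i. \<sigma> i * v i)) \<partial>(\<Pi>\<^sub>M j\<in>UNIV. std_normal))"
  unfolding gauss_law_def by (rule nn_integral_distr[OF measurable_gauss_map]) simp

text \<open>Independence of the rotated coordinates; it reduces the vector integrals of information
  densities to one dimension.\<close>

lemma nn_integral_gauss_law_prod:
  assumes [measurable]: "\<And>i. h i \<in> borel_measurable borel"
  shows "(\<integral>\<^sup>+ y. (\<Prod>i\<in>UNIV. h i (T y $ i)) \<partial>gauss_law T \<sigma>) = (\<Prod>i\<in>UNIV. \<integral>\<^sup>+ w. h i (\<sigma> i * w) \<partial>std_normal)"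
proof -
  interpret product_prob_space "\<lambda>_::'m. std_normal" UNIV
    by (intro product_prob_space.intro product_sigma_finite.intro product_prob_space_axioms.intro
        prob_space_imp_sigma_finite prob_space_std_normal)
  note [measurable] = borel_measurable_T
  have "(\<lambda>y. \<Prod>i\<in>UNIV. h i (T y $ i)) \<in> borel_measurable borel"
    by measurable
  then show ?thesis
    by (subst nn_integral_gauss_law) (auto intro!: product_nn_integral_prod)
qed

lemma nn_integral_gauss_law_square:
  "(\<integral>\<^sup>+ y. ennreal ((T y $ k)\<^sup>2) \<partial>gauss_law T \<sigma>) = ennreal ((\<sigma> k)\<^sup>2)"
proof -
  let ?h = "\<lambda>i x. if i = k then ennreal (x\<^sup>2) else 1"
  have "(\<integral>\<^sup>+ y. ennreal ((T y $ k)\<^sup>2) \<partial>gauss_law T \<sigma>) = (\<integral>\<^sup>+ y. (\<Prod>i\<in>UNIV. ?h i (T y $ i)) \<partial>gauss_law T \<sigma>)"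
    by (intro nn_integral_cong) (simp add: prod.delta)
  also have "\<dots> = (\<Prod>i\<in>UNIV. \<integral>\<^sup>+ w. ?h i (\<sigma> i * w) \<partial>std_normal)"
    by (rule nn_integral_gauss_law_prod) auto
  also have "\<dots> = (\<Prod>i\<in>UNIV. if i = k then ennreal ((\<sigma> k)\<^sup>2) else 1)"
    using nn_integral_std_normal_affine_square[of "\<sigma> k" 0] prob_space.emeasure_space_1[OF prob_space_std_normal]
    by (intro prod.cong) auto
  finally show ?thesis by (simp add: prod.delta)
qed

lemma norm_eq_sum_coords: "(norm x)\<^sup>2 = (\<Sum>i\<in>UNIV. (T x $ i)\<^sup>2)"
proof -
  have "norm x = norm (T x)" using T by (simp add: orthogonal_transformation_norm)
  then show ?thesis by (simp add: norm_vec_def L2_set_def sum_nonneg)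
qed

lemma T_diff: "T (x - y) = T x - T y"
  using orthogonal_transformation_linear[OF T] by (rule linear_diff)

lemma norm_diff_eq_sum_coords: "(norm (x - y))\<^sup>2 = (\<Sum>i\<in>UNIV. (T x $ i - T y $ i)\<^sup>2)"
  by (subst norm_eq_sum_coords) (simp add: T_diff)

end

section \<open>Lower bound on the distortion\<close>

lemma ennreal_exp_sum:
  "finite A \<Longrightarrow> ennreal (exp (\<Sum>i\<in>A. f i)) = (\<Prod>i\<in>A. ennreal (exp (f i)))"
  by (simp add: exp_sum prod_ennreal)

text \<open>The product of \<open>max \<delta> (l i)\<close> and \<open>min \<delta> (l i)\<close>
  is \<open>\<delta> * l i\<close>. This turns the source terms of the rate bound into the
  water-filling distortion.\<close>

lemma sum_ratio_max:
  fixes l :: "'i \<Rightarrow> real"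
  assumes "0 < \<delta>" "\<And>i. i \<in> A \<Longrightarrow> 0 < l i"
  shows "(\<Sum>i\<in>A. l i / (2 * max \<delta> (l i))) = (\<Sum>i\<in>A. min \<delta> (l i)) / (2 * \<delta>)"
  unfolding sum_divide_distrib using assms
  by (intro sum.cong refl) (auto simp: max_def min_def field_simps)

locale gauss_channel =
  fixes T :: "real ^ 'm::finite \<Rightarrow> real ^ 'm" and l :: "'m \<Rightarrow> real" and K :: "'m kernel"
  assumes T: "orthogonal_transformation T" and l_pos: "\<And>i. 0 < l i" and K: "K \<in> kernels"
begin

abbreviation "P \<equiv> gauss_law T (\<lambda>i. sqrt (l i))"
abbreviation "Q \<equiv> channel_law P K"

lemma P_prob: "prob_space P" by (rule prob_space_gauss_law[OF T])

sublocale Q: prob_space Q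
  by (rule prob_space_channel_law[OF P_prob _ K]) simp

lemma sets_Q [simp, measurable_cong]: "sets Q = sets (borel \<Otimes>\<^sub>M borel)"
  by (rule sets_channel_law[OF P_prob _ K]) simp

lemma measurable_T [measurable]: "T \<in> borel_measurable borel" "inv T \<in> borel_measurable borel"
  by (rule borel_measurable_T[OF T])+

lemma has_bochner_integral_source: "has_bochner_integral Q (\<lambda>(y, z). (T y $ i)\<^sup>2) (l i)"
proof (rule has_bochner_integral_nn_integral)
  have "(\<integral>\<^sup>+ x. ennreal (case x of (y, z) \<Rightarrow> (T y $ i)\<^sup>2) \<partial>Q) =
      (\<integral>\<^sup>+ y. \<integral>\<^sup>+ z. ennreal ((T y $ i)\<^sup>2) \<partial>K y \<partial>P)"
    by (subst nn_integral_channel_law[OF P_prob _ K]) auto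
  also have "\<dots> = ennreal (l i)"
    using nn_integral_gauss_law_square[OF T, of "\<lambda>i. sqrt (l i)" i] l_pos[of i]
    by (simp add: prob_space.emeasure_space_1[OF kernels_prob(1)[OF K]])
  finally show "(\<integral>\<^sup>+ x. ennreal (case x of (y, z) \<Rightarrow> (T y $ i)\<^sup>2) \<partial>Q) = ennreal (l i)" .
qed (use l_pos[of i] in auto)

text \<open>The map \<open>h\<close> is kept general because one output coordinate will later be
  replaced by an arbitrary estimator. A Bochner integral defaults to 0, so the lemmas tying
  \<open>err\<close> to the distortion assume that the latter is finite.\<close>

definition err :: "(real ^ 'm \<Rightarrow> real ^ 'm) \<Rightarrow> 'm \<Rightarrow> real" where
  "err h i = (\<integral>(y, z). (T y $ i - T (h z) $ i)\<^sup>2 \<partial>Q)"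

lemma err_nonneg: "0 \<le> err h i"
  unfolding err_def by (rule integral_nonneg_AE) auto

lemma integrable_err:
  assumes [measurable]: "h \<in> borel_measurable borel"
    and fin: "(\<integral>\<^sup>+ (y, z). ennreal ((norm (y - h z))\<^sup>2) \<partial>Q) < \<infinity>"
  shows "integrable Q (\<lambda>(y, z). (T y $ i - T (h z) $ i)\<^sup>2)"
proof (rule integrableI_nonneg)
  have "(\<integral>\<^sup>+ x. ennreal (case x of (y, z) \<Rightarrow> (T y $ i - T (h z) $ i)\<^sup>2) \<partial>Q) \<le>
      (\<integral>\<^sup>+ (y, z). ennreal ((norm (y - h z))\<^sup>2) \<partial>Q)"
    by (intro nn_integral_mono)
       (auto simp: norm_diff_eq_sum_coords[OF T] intro!: ennreal_leI member_le_sum)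
  also note fin
  finally show "(\<integral>\<^sup>+ x. ennreal (case x of (y, z) \<Rightarrow> (T y $ i - T (h z) $ i)\<^sup>2) \<partial>Q) < \<infinity>" .
qed auto

lemma distortion_eq_sum_err:
  assumes h [measurable]: "h \<in> borel_measurable borel"
    and fin: "(\<integral>\<^sup>+ (y, z). ennreal ((norm (y - h z))\<^sup>2) \<partial>Q) < \<infinity>"
  shows "(\<integral>\<^sup>+ (y, z). ennreal ((norm (y - h z))\<^sup>2) \<partial>Q) = ennreal (\<Sum>i\<in>UNIV. err h i)"
proof -
  have "(\<integral>\<^sup>+ (y, z). ennreal ((norm (y - h z))\<^sup>2) \<partial>Q) =
      (\<integral>\<^sup>+ x. ennreal (\<Sum>i\<in>UNIV. (\<lambda>(y, z). (T y $ i - T (h z) $ i)\<^sup>2) x) \<partial>Q)"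
    by (intro nn_integral_cong) (auto simp: norm_diff_eq_sum_coords[OF T])
  also have "\<dots> = ennreal (\<integral>x. (\<Sum>i\<in>UNIV. (\<lambda>(y, z). (T y $ i - T (h z) $ i)\<^sup>2) x) \<partial>Q)"
    using integrable_err[OF h fin]
    by (intro nn_integral_eq_integral Bochner_Integration.integrable_sum AE_I2 sum_nonneg) auto
  also have "\<dots> = ennreal (\<Sum>i\<in>UNIV. err h i)"
    unfolding err_def using integrable_err[OF h fin] by (subst Bochner_Integration.integral_sum) auto
  finally show ?thesis .
qed

text \<open>The information density is quadratic and the second moments \<open>l i\<close> are fixed
  by the source, so its mean depends on the kernel only through the coordinate errors.\<close>

lemma has_bochner_integral_info:
  assumes h: "h \<in> borel_measurable borel"
    and fin: "(\<integral>\<^sup>+ (y, z). ennreal ((norm (y - h z))\<^sup>2) \<partial>Q) < \<infinity>"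
  shows "has_bochner_integral Q
    (\<lambda>x. \<Sum>i\<in>UNIV. info_term (e i) (d i) (T (fst x) $ i) (T (h (snd x)) $ i))
    (\<Sum>i\<in>UNIV. ln (e i / d i) / 2 - err h i / (2 * d i) + l i / (2 * e i))"
proof (intro has_bochner_integral_sum)
  fix i
  have 1: "has_bochner_integral Q (\<lambda>x. (T (fst x) $ i - T (h (snd x)) $ i)\<^sup>2) (err h i)"
    using integrable_err[OF h fin, of i] unfolding err_def has_bochner_integral_iff
    by (simp add: case_prod_unfold)
  have 2: "has_bochner_integral Q (\<lambda>x. (T (fst x) $ i)\<^sup>2) (l i)"
    using has_bochner_integral_source[of i] by (simp add: case_prod_unfold)
  have 0: "has_bochner_integral Q (\<lambda>x. c) c" for c :: real
    by (simp add: has_bochner_integral_iff Q.prob_space)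
  show "has_bochner_integral Q (\<lambda>x. info_term (e i) (d i) (T (fst x) $ i) (T (h (snd x)) $ i))
      (ln (e i / d i) / 2 - err h i / (2 * d i) + l i / (2 * e i))"
    unfolding info_term_def
    by (intro has_bochner_integral_add has_bochner_integral_diff has_bochner_integral_divide 0 1 2)
qed

text \<open>The point \<open>z\<close> is fixed and arbitrary, so the output law does not enter and
  \<open>T (h z)\<close> may be inserted for any \<open>h\<close>.\<close>

lemma nn_integral_exp_info_le:
  assumes d: "\<And>i. 0 < d i" and e: "\<And>i. e i = l i \<or> (e i = d i \<and> l i \<le> d i)"
  shows "(\<integral>\<^sup>+ y. ennreal (exp (\<Sum>i\<in>UNIV. info_term (e i) (d i) (T y $ i) (z $ i))) \<partial>P) \<le> 1"
proof -
  have "(\<integral>\<^sup>+ y. ennreal (exp (\<Sum>i\<in>UNIV. info_term (e i) (d i) (T y $ i) (z $ i))) \<partial>P) =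
      (\<Prod>i\<in>UNIV. \<integral>\<^sup>+ w. ennreal (exp (info_term (e i) (d i) (sqrt (l i) * w) (z $ i))) \<partial>std_normal)"
    unfolding ennreal_exp_sum[OF finite]
    by (rule nn_integral_gauss_law_prod[OF T, where h="\<lambda>i x. ennreal (exp (info_term (e i) (d i) x (z $ i)))"]) auto
  also have "\<dots> \<le> 1"
  proof (rule prod_le_1)
    fix i
    show "0 \<le> (\<integral>\<^sup>+ w. ennreal (exp (info_term (e i) (d i) (sqrt (l i) * w) (z $ i))) \<partial>std_normal) \<and>
        (\<integral>\<^sup>+ w. ennreal (exp (info_term (e i) (d i) (sqrt (l i) * w) (z $ i))) \<partial>std_normal) \<le> 1"
      using e[of i] d[of i] l_pos[of i] nn_integral_info_active(1)[of "l i" "d i" "z $ i"]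
        nn_integral_info_inactive[of "l i" "d i" "z $ i"] by auto
  qed
  finally show ?thesis .
qed

text \<open>Donsker-Varadhan with the exponential of \<open>L\<close>. Post-processing sits inside
  \<open>L\<close>, so no data processing inequality is needed. The parameters \<open>d\<close> stay
  free because one of them will be varied.\<close>

lemma rate_lower_bound:
  assumes d: "\<And>i. 0 < d i" and e: "\<And>i. e i = l i \<or> (e i = d i \<and> l i \<le> d i)"
    and h [measurable]: "h \<in> borel_measurable borel"
    and fin: "(\<integral>\<^sup>+ (y, z). ennreal ((norm (y - h z))\<^sup>2) \<partial>Q) < \<infinity>"
    and rate: "channel_rate P K \<le> ereal R"
  shows "(\<Sum>i\<in>UNIV. ln (e i / d i) / 2 - err h i / (2 * d i) + l i / (2 * e i)) \<le> R * ln 2"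
proof -
  define PZ where "PZ = distr Q borel snd"
  interpret PP: pair_prob_space P PZ
    unfolding PZ_def
    by (intro pair_prob_space.intro pair_sigma_finite.intro prob_space_imp_sigma_finite P_prob Q.prob_space_distr) auto
  have [measurable_cong, simp]: "sets PZ = sets borel" by (simp add: PZ_def)
  have sPP: "sets Q = sets (P \<Otimes>\<^sub>M PZ)"
    unfolding sets_Q by (intro sets_pair_measure_cong) auto
  define L where "L x = (\<Sum>i\<in>UNIV. info_term (e i) (d i) (T (fst x) $ i) (T (h (snd x)) $ i))" for x
  have [measurable]: "L \<in> borel_measurable (P \<Otimes>\<^sub>M PZ)" unfolding L_def by measurable
  have L_int: "has_bochner_integral Q L (\<Sum>i\<in>UNIV. ln (e i / d i) / 2 - err h i / (2 * d i) + l i / (2 * e i))"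
    unfolding L_def
    by (rule has_bochner_integral_info[OF h fin])
  have "(\<integral>x. log 2 (exp (L x)) \<partial>Q) \<le> KL_divergence 2 (P \<Otimes>\<^sub>M PZ) Q"
  proof (rule Donsker_Varadhan_le_KL_divergence)
    show "prob_space (P \<Otimes>\<^sub>M PZ)" by (rule PP.P.prob_space_axioms)
    show "(\<integral>\<^sup>+ x. ennreal (exp (L x)) \<partial>(P \<Otimes>\<^sub>M PZ)) \<le> 1"
    proof -
      have "(\<integral>\<^sup>+ x. ennreal (exp (L x)) \<partial>(P \<Otimes>\<^sub>M PZ)) =
          (\<integral>\<^sup>+ z. \<integral>\<^sup>+ y. ennreal (exp (L (y, z))) \<partial>P \<partial>PZ)"
        by (subst PP.nn_integral_snd) auto
      also have "\<dots> \<le> (\<integral>\<^sup>+ z. 1 \<partial>PZ)"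
        unfolding L_def fst_conv snd_conv by (intro nn_integral_mono nn_integral_exp_info_le d e)
      also have "\<dots> = 1" by (simp add: PP.M2.emeasure_space_1)
      finally show ?thesis .
    qed
    show "integrable Q (\<lambda>x. log 2 (exp (L x)))"
      using L_int by (simp add: log_def has_bochner_integral_iff)
  qed (use channel_rate_finite[OF P_prob _ K rate] sPP Q.prob_space_axioms in \<open>auto simp: PZ_def\<close>)
  also have "\<dots> \<le> R"
    using channel_rate_finite(3)[OF P_prob _ K rate] by (simp add: PZ_def)
  finally have "(\<integral>x. L x \<partial>Q) / ln 2 \<le> R" by (simp add: log_def)
  then show ?thesis
    using L_int by (simp add: has_bochner_integral_iff divide_le_eq)
qed

end

text \<open>The equation \<open>level\<close> says that the water-filling rate at level \<delta>, in
  nats, amounts to \<open>R\<close> bits; coordinates below the level contribute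
  \<open>ln 1 = 0\<close>.\<close>

locale waterfilling = gauss_channel T l K
  for T :: "real ^ 'm::finite \<Rightarrow> real ^ 'm" and l and K +
  fixes \<delta> R :: real
  assumes \<delta>_pos: "0 < \<delta>" and level: "(\<Sum>i\<in>UNIV. ln (max \<delta> (l i) / \<delta>) / 2) = R * ln 2"
    and rate: "channel_rate P K \<le> ereal R"
begin

text \<open>By \<open>level\<close> the logarithms in the rate bound cancel its right side. The rest
  is linear in the errors, all with the same weight \<open>1 / (2 * \<delta>)\<close>, so it bounds
  their sum.\<close>

lemma distortion_lower_bound:
  assumes h [measurable]: "h \<in> borel_measurable borel"
  shows "ennreal (\<Sum>i\<in>UNIV. min \<delta> (l i)) \<le> (\<integral>\<^sup>+ (y, z). ennreal ((norm (y - h z))\<^sup>2) \<partial>Q)"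
proof (cases "(\<integral>\<^sup>+ (y, z). ennreal ((norm (y - h z))\<^sup>2) \<partial>Q) < \<infinity>")
  case fin: True
  have "(\<Sum>i\<in>UNIV. ln (max \<delta> (l i) / \<delta>) / 2 - err h i / (2 * \<delta>) + l i / (2 * max \<delta> (l i))) \<le> R * ln 2"
    using \<delta>_pos by (intro rate_lower_bound[OF _ _ h fin rate]) auto
  then have "(\<Sum>i\<in>UNIV. l i / (2 * max \<delta> (l i))) \<le> (\<Sum>i\<in>UNIV. err h i / (2 * \<delta>))"
    using level by (simp add: sum.distrib sum_subtractf)
  also have "(\<Sum>i\<in>UNIV. l i / (2 * max \<delta> (l i))) = (\<Sum>i\<in>UNIV. min \<delta> (l i)) / (2 * \<delta>)"
    by (rule sum_ratio_max) (use l_pos \<delta>_pos in auto)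
  finally have "(\<Sum>i\<in>UNIV. min \<delta> (l i)) \<le> (\<Sum>i\<in>UNIV. err h i)"
    using \<delta>_pos by (simp add: sum_divide_distrib[symmetric] divide_le_cancel)
  then show ?thesis
    unfolding distortion_eq_sum_err[OF h fin] by (rule ennreal_leI)
qed (auto simp: less_top[symmetric])

text \<open>Replacing \<open>d k = \<delta>\<close> by \<open>t * \<delta>\<close> in \<open>rate_lower_bound\<close> gives \<open>ln t + x / t \<ge> x\<close> for all \<open>t > 0\<close>, where
  \<open>x\<close> is the error in coordinate \<open>k\<close> divided by \<open>\<delta>\<close>; taking \<open>t = x\<close> forces \<open>x = 1\<close>.\<close>

lemma err_eq_level:
  assumes opt: "channel_distortion P K = ennreal (\<Sum>i\<in>UNIV. min \<delta> (l i))" and k: "\<delta> \<le> l k"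
  shows "err (\<lambda>z. z) k = \<delta>"
proof -
  let ?E = "err (\<lambda>z. z)"
  have D: "(\<integral>\<^sup>+ (y, z). ennreal ((norm (y - z))\<^sup>2) \<partial>Q) = ennreal (\<Sum>i\<in>UNIV. min \<delta> (l i))"
    using opt by (simp add: channel_distortion_def)
  then have fin: "(\<integral>\<^sup>+ (y, z). ennreal ((norm (y - z))\<^sup>2) \<partial>Q) < \<infinity>" by simp
  have "ennreal (\<Sum>i\<in>UNIV. ?E i) = ennreal (\<Sum>i\<in>UNIV. min \<delta> (l i))"
    using distortion_eq_sum_err[OF _ fin] D by simp
  then have sum_E: "(\<Sum>i\<in>UNIV. ?E i) = (\<Sum>i\<in>UNIV. min \<delta> (l i))"
    using \<delta>_pos l_pos by (subst (asm) ennreal_inj) (auto intro!: sum_nonneg err_nonneg simp: less_imp_le)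
  define x where "x = ?E k / \<delta>"
  have x: "0 \<le> ln t + x / t - x" if t: "0 < t" for t
  proof -
    define d where "d i = (if i = k then t * \<delta> else \<delta>)" for i
    \<comment> \<open>Since \<open>\<delta> \<le> l k\<close>, the parameter \<open>e\<close> is
      \<open>l k\<close> at \<open>k\<close>, and the first alternative of the hypothesis on
      \<open>e\<close> holds for every \<open>t\<close>. A coordinate strictly below the level would
      not allow this variation.\<close>
    have "(\<Sum>i\<in>UNIV. ln (max \<delta> (l i) / d i) / 2 - ?E i / (2 * d i) + l i / (2 * max \<delta> (l i))) \<le> R * ln 2"
      using \<delta>_pos t k by (intro rate_lower_bound[OF _ _ _ fin rate]) (auto simp: d_def)
    moreover have "(\<Sum>i\<in>UNIV. ln (max \<delta> (l i) / d i) / 2 - ?E i / (2 * d i) + l i / (2 * max \<delta> (l i))) =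
      (\<Sum>i\<in>UNIV. ln (max \<delta> (l i) / \<delta>) / 2 - ?E i / (2 * \<delta>) + min \<delta> (l i) / (2 * \<delta>)
          + (if i = k then (x - ln t - x / t) / 2 else 0))"
    proof (intro sum.cong refl)
      fix i
      have 1: "l i / (2 * max \<delta> (l i)) = min \<delta> (l i) / (2 * \<delta>)"
        using \<delta>_pos l_pos[of i] by (auto simp: max_def min_def field_simps)
      have 2: "ln (max \<delta> (l i) / (t * \<delta>)) = ln (max \<delta> (l i) / \<delta>) - ln t"
        using \<delta>_pos t l_pos[of i] by (simp add: ln_div ln_mult less_max_iff_disj)
      have 3: "?E k / (2 * (t * \<delta>)) = x / t / 2" "?E k / (2 * \<delta>) = x / 2"
        using \<delta>_pos t by (auto simp: x_def)
      show "ln (max \<delta> (l i) / d i) / 2 - ?E i / (2 * d i) + l i / (2 * max \<delta> (l i)) =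
        ln (max \<delta> (l i) / \<delta>) / 2 - ?E i / (2 * \<delta>) + min \<delta> (l i) / (2 * \<delta>)
          + (if i = k then (x - ln t - x / t) / 2 else 0)"
        unfolding 1 d_def using 2 3 by (auto simp: diff_divide_distrib)
    qed
    ultimately show ?thesis
      using level sum_E
      by (simp add: sum.distrib sum_subtractf sum_divide_distrib[symmetric] sum.delta)
  qed
  \<comment> \<open>The choice \<open>t = x\<close> needs \<open>x > 0\<close>. For
    \<open>x = 0\<close> the inequality at \<open>t = 1/2\<close> would make \<open>ln (1/2)\<close>
    nonnegative.\<close>
  have "0 < x"
  proof (rule ccontr)
    assume "\<not> 0 < x"
    moreover have "0 \<le> x" using \<delta>_pos err_nonneg by (simp add: x_def)
    ultimately have "x = 0" by simp
    with x[of "1/2"] show False by (simp add: ln_div)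
  qed
  with x[of x] have "x - 1 \<le> ln x" by simp
  with ln_le_minus_one[OF \<open>0 < x\<close>] have "ln x = x - 1" by simp
  with \<open>0 < x\<close> have "x = 1" by (rule ln_eq_minus_one)
  then show ?thesis using \<delta>_pos by (simp add: x_def)
qed

lemma coord_error_attained:
  assumes opt: "channel_distortion P K = ennreal (\<Sum>i\<in>UNIV. min \<delta> (l i))" and k: "\<delta> \<le> l k"
  shows "(\<integral>\<^sup>+ (y, z). ennreal ((T y $ k - T z $ k)\<^sup>2) \<partial>Q) = ennreal \<delta>"
proof -
  have "integrable Q (\<lambda>(y, z). (T y $ k - T z $ k)\<^sup>2)"
    using integrable_err[of "\<lambda>z. z" k] opt by (simp add: channel_distortion_def)
  then have "(\<integral>\<^sup>+ x. ennreal (case x of (y, z) \<Rightarrow> (T y $ k - T z $ k)\<^sup>2) \<partial>Q) = ennreal (err (\<lambda>z. z) k)"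
    unfolding err_def by (rule nn_integral_eq_integral) auto
  then show ?thesis unfolding err_eq_level[OF opt k] by (simp add: case_prod_unfold)
qed

lemma coord_error_lower_bound:
  assumes opt: "channel_distortion P K = ennreal (\<Sum>i\<in>UNIV. min \<delta> (l i))" and k: "\<delta> \<le> l k"
    and f [measurable]: "f \<in> borel_measurable borel"
  shows "ennreal \<delta> \<le> (\<integral>\<^sup>+ (y, z). ennreal ((T y $ k - f z)\<^sup>2) \<partial>Q)"
proof -
  define S where "S = (\<integral>\<^sup>+ (y, z). ennreal (\<Sum>i\<in>UNIV - {k}. (T y $ i - T z $ i)\<^sup>2) \<partial>Q)"
  \<comment> \<open>Only coordinate \<open>k\<close> of the output, in the rotated basis, is
    replaced by the competing estimator; \<open>S\<close> collects the errors that stay the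
    same.\<close>
  define h where "h z = inv T (\<chi> i. if i = k then f z else T z $ i)" for z
  have h [measurable]: "h \<in> borel_measurable borel" unfolding h_def by measurable
  have split: "(\<integral>\<^sup>+ (y, z). ennreal ((norm (y - h z))\<^sup>2) \<partial>Q) = (\<integral>\<^sup>+ (y, z). ennreal ((T y $ k - f z)\<^sup>2) \<partial>Q) + S"
  proof -
    have "(norm (y - h z))\<^sup>2 = (T y $ k - f z)\<^sup>2 + (\<Sum>i\<in>UNIV - {k}. (T y $ i - T z $ i)\<^sup>2)" for y z
      unfolding norm_diff_eq_sum_coords[OF T] h_def
      by (subst sum.remove[of UNIV k]) (auto simp: T_inv[OF T] intro!: sum.cong)
    then have "(\<integral>\<^sup>+ (y, z). ennreal ((norm (y - h z))\<^sup>2) \<partial>Q) =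
        (\<integral>\<^sup>+ x. (case x of (y, z) \<Rightarrow> ennreal ((T y $ k - f z)\<^sup>2)) +
          (case x of (y, z) \<Rightarrow> ennreal (\<Sum>i\<in>UNIV - {k}. (T y $ i - T z $ i)\<^sup>2)) \<partial>Q)"
      by (intro nn_integral_cong) (auto simp: sum_nonneg)
    also have "\<dots> = (\<integral>\<^sup>+ (y, z). ennreal ((T y $ k - f z)\<^sup>2) \<partial>Q) + S"
      unfolding S_def by (rule nn_integral_add) auto
    finally show ?thesis .
  qed
  have D: "(\<integral>\<^sup>+ (y, z). ennreal ((norm (y - z))\<^sup>2) \<partial>Q) = ennreal (\<Sum>i\<in>UNIV. min \<delta> (l i))"
    using opt by (simp add: channel_distortion_def)
  have D_split: "(\<integral>\<^sup>+ (y, z). ennreal ((norm (y - z))\<^sup>2) \<partial>Q) = ennreal \<delta> + S"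
  proof -
    have "(norm (y - z))\<^sup>2 = (T y $ k - T z $ k)\<^sup>2 + (\<Sum>i\<in>UNIV - {k}. (T y $ i - T z $ i)\<^sup>2)" for y z
      unfolding norm_diff_eq_sum_coords[OF T] by (rule sum.remove) auto
    then have "(\<integral>\<^sup>+ (y, z). ennreal ((norm (y - z))\<^sup>2) \<partial>Q) =
        (\<integral>\<^sup>+ x. (case x of (y, z) \<Rightarrow> ennreal ((T y $ k - T z $ k)\<^sup>2)) +
          (case x of (y, z) \<Rightarrow> ennreal (\<Sum>i\<in>UNIV - {k}. (T y $ i - T z $ i)\<^sup>2)) \<partial>Q)"
      by (intro nn_integral_cong) (auto simp: sum_nonneg)
    also have "\<dots> = (\<integral>\<^sup>+ (y, z). ennreal ((T y $ k - T z $ k)\<^sup>2) \<partial>Q) + S"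
      unfolding S_def by (rule nn_integral_add) auto
    also have "(\<integral>\<^sup>+ (y, z). ennreal ((T y $ k - T z $ k)\<^sup>2) \<partial>Q) = ennreal \<delta>"
      by (rule coord_error_attained[OF opt k])
    finally show ?thesis .
  qed
  \<comment> \<open>Cancelling \<open>S\<close> in \<open>ennreal\<close> requires finiteness;
    \<open>S\<close> is a summand of the finite optimal distortion.\<close>
  have "S \<noteq> \<infinity>" using D D_split by (metis ennreal_add_eq_top ennreal_neq_top infinity_ennreal_def)
  moreover have "ennreal \<delta> + S \<le> (\<integral>\<^sup>+ (y, z). ennreal ((T y $ k - f z)\<^sup>2) \<partial>Q) + S"
    using distortion_lower_bound[OF h] unfolding split D[symmetric] D_split .
  ultimately show ?thesis by (simp add: add.commute[of _ S] ennreal_add_left_cancel_le)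
qed

end

section \<open>The water-filling kernel\<close>

locale water_level =
  fixes T :: "real ^ 'm::finite \<Rightarrow> real ^ 'm" and l :: "'m \<Rightarrow> real" and \<delta> R :: real
  assumes T: "orthogonal_transformation T" and l_pos: "\<And>i. 0 < l i" and \<delta>_pos: "0 < \<delta>"
    and level: "(\<Sum>i\<in>UNIV. ln (max \<delta> (l i) / \<delta>) / 2) = R * ln 2"
begin

lemma measurable_T [measurable]: "T \<in> borel_measurable borel" "inv T \<in> borel_measurable borel"
  by (rule borel_measurable_T[OF T])+

definition "src = gauss_law T (\<lambda>i. sqrt (l i))"
definition "out_sd i = sqrt (l i - min \<delta> (l i))"
definition "out = gauss_law T out_sd"
definition "info y z = (\<Sum>i\<in>UNIV. info_term (max \<delta> (l i)) \<delta> (T y $ i) (T z $ i))"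
text \<open>Bayes' rule applied to the backward test channel. Written as a density with respect to
  the output law, it has \<open>info\<close> as information density by construction and needs no
  case distinction for degenerate output coordinates.\<close>

definition "opt_kernel y = density out (\<lambda>z. ennreal (exp (info y z)))"

lemma sets_src [simp, measurable_cong]: "sets src = sets borel"
  and sets_out [simp, measurable_cong]: "sets out = sets borel"
  by (simp_all add: src_def out_def)

lemma space_src [simp]: "space src = UNIV"
  and space_out [simp]: "space out = UNIV"
  by (simp_all add: src_def out_def)

sublocale src: prob_space src unfolding src_def by (rule prob_space_gauss_law[OF T])
sublocale out: prob_space out unfolding out_def by (rule prob_space_gauss_law[OF T])
sublocale pair: pair_prob_space src out ..

lemma measurable_info [measurable (raw)]:
  assumes [measurable]: "f \<in> borel_measurable M" "g \<in> borel_measurable M"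
  shows "(\<lambda>x. info (f x) (g x)) \<in> borel_measurable M"
  unfolding info_def by measurable

lemma nn_integral_exp_info_out: "(\<integral>\<^sup>+ z. ennreal (exp (info y z)) \<partial>out) = 1"
proof -
  have "(\<integral>\<^sup>+ z. ennreal (exp (info y z)) \<partial>out) =
      (\<Prod>i\<in>UNIV. \<integral>\<^sup>+ w. ennreal (exp (info_term (max \<delta> (l i)) \<delta> (T y $ i) (out_sd i * w))) \<partial>std_normal)"
    unfolding ennreal_exp_sum[OF finite] info_def out_def
    by (rule nn_integral_gauss_law_prod[OF T, where h="\<lambda>i x. ennreal (exp (info_term (max \<delta> (l i)) \<delta> (T y $ i) x))"]) auto
  also have "\<dots> = (\<Prod>i\<in>(UNIV::'m set). 1)"
  proof (rule prod.cong[OF refl])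
    fix i
    show "(\<integral>\<^sup>+ w. ennreal (exp (info_term (max \<delta> (l i)) \<delta> (T y $ i) (out_sd i * w))) \<partial>std_normal) = 1"
    proof (cases "\<delta> < l i")
      case True
      then show ?thesis
        using nn_integral_info_backward[OF \<delta>_pos True, of "T y $ i"] by (simp add: out_sd_def max_def min_def)
    next
      \<comment> \<open>The output coordinate is constantly 0 and the density there is
        \<open>exp 0\<close>. This includes the boundary case \<open>\<delta> = l i\<close>.\<close>
      case False
      then show ?thesis
        using \<delta>_pos prob_space.emeasure_space_1[OF prob_space_std_normal] by (simp add: out_sd_def max_def min_def)
    qed
  qed
  finally show ?thesis by simp
qed

lemma nn_integral_src_out_coords:
  assumes [measurable]: "\<And>i. h i \<in> borel_measurable borel"
  shows "(\<integral>\<^sup>+ y. (\<Prod>i\<in>UNIV. ennreal (exp (info_term (max \<delta> (l i)) \<delta> (T y $ i) (z i))) * h i (T y $ i)) \<partial>src) =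
    (\<Prod>i\<in>UNIV. \<integral>\<^sup>+ w. ennreal (exp (info_term (max \<delta> (l i)) \<delta> (sqrt (l i) * w) (z i))) * h i (sqrt (l i) * w) \<partial>std_normal)"
  unfolding src_def
  by (rule nn_integral_gauss_law_prod[OF T,
      where h="\<lambda>i x. ennreal (exp (info_term (max \<delta> (l i)) \<delta> x (z i))) * h i x"]) auto

text \<open>In an active coordinate the tilted source is normal with variance \<delta> around the
  output. In an inactive one the output is 0 and there is no tilt, so the error is the full variance
  \<open>l i\<close>.\<close>

lemma nn_integral_info_coord:
  "(\<integral>\<^sup>+ w. ennreal (exp (info_term (max \<delta> (l i)) \<delta> (sqrt (l i) * w) (out_sd i * v))) \<partial>std_normal) = 1"
  "(\<integral>\<^sup>+ w. ennreal (exp (info_term (max \<delta> (l i)) \<delta> (sqrt (l i) * w) (out_sd i * v))) *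
      ennreal ((sqrt (l i) * w - out_sd i * v)\<^sup>2) \<partial>std_normal) = ennreal (min \<delta> (l i))"
  using nn_integral_info_active[OF l_pos \<delta>_pos, of i "out_sd i * v"] \<delta>_pos l_pos[of i]
    prob_space.emeasure_space_1[OF prob_space_std_normal]
    nn_integral_std_normal_affine_square[of "sqrt (l i)" 0]
  by (cases "\<delta> < l i"; simp add: out_sd_def max_def min_def)+

text \<open>Stated only at points in the range of the map defining \<open>out\<close>: in a
  coordinate strictly below the level, mass exactly 1 requires output 0.\<close>

lemma nn_integral_exp_info_src:
  "(\<integral>\<^sup>+ y. ennreal (exp (info y (inv T (\<chi> i. out_sd i * v i)))) \<partial>src) = 1"
  using nn_integral_src_out_coords[of "\<lambda>_ _. 1" "\<lambda>i. out_sd i * v i"]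
  by (simp add: info_def ennreal_exp_sum[OF finite] T_inv[OF T] nn_integral_info_coord)

lemma nn_integral_exp_info_src_square:
  "(\<integral>\<^sup>+ y. ennreal (exp (info y (inv T (\<chi> i. out_sd i * v i)))) *
     ennreal ((T y $ k - out_sd k * v k)\<^sup>2) \<partial>src) = ennreal (min \<delta> (l k))"
proof -
  let ?h = "\<lambda>i x. if i = k then ennreal ((x - out_sd k * v k)\<^sup>2) else 1"
  have "(\<integral>\<^sup>+ y. ennreal (exp (info y (inv T (\<chi> i. out_sd i * v i)))) *
     ennreal ((T y $ k - out_sd k * v k)\<^sup>2) \<partial>src) =
     (\<integral>\<^sup>+ y. (\<Prod>i\<in>UNIV. ennreal (exp (info_term (max \<delta> (l i)) \<delta> (T y $ i) (out_sd i * v i))) * ?h i (T y $ i)) \<partial>src)"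
    by (simp add: info_def ennreal_exp_sum[OF finite] T_inv[OF T] prod.distrib prod.delta)
  also have "\<dots> = (\<Prod>i\<in>UNIV. \<integral>\<^sup>+ w. ennreal (exp (info_term (max \<delta> (l i)) \<delta> (sqrt (l i) * w) (out_sd i * v i))) *
      ?h i (sqrt (l i) * w) \<partial>std_normal)"
    by (rule nn_integral_src_out_coords) auto
  also have "\<dots> = (\<Prod>i\<in>UNIV. if i = k then ennreal (min \<delta> (l k)) else 1)"
    by (rule prod.cong[OF refl]) (auto simp: nn_integral_info_coord)
  finally show ?thesis by (simp add: prod.delta)
qed

lemma opt_kernel_in_kernels: "opt_kernel \<in> kernels"
  unfolding kernels_def
proof (rule measurable_prob_algebraI)
  show p: "prob_space (opt_kernel y)" for y
    by (rule prob_spaceI) (simp add: opt_kernel_def emeasure_density nn_integral_exp_info_out)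
  show "opt_kernel \<in> borel \<rightarrow>\<^sub>M subprob_algebra borel"
  proof (rule measurable_subprob_algebra)
    fix A :: "(real ^ 'm) set" assume A [measurable]: "A \<in> sets borel"
    have "(\<lambda>y. \<integral>\<^sup>+ z. ennreal (exp (info y z)) * indicator A z \<partial>out) \<in> borel_measurable borel"
      by measurable
    then show "(\<lambda>y. emeasure (opt_kernel y) A) \<in> borel_measurable borel"
      by (simp add: opt_kernel_def emeasure_density)
  qed (auto simp: opt_kernel_def p[unfolded opt_kernel_def] intro: prob_space_imp_subprob_space)
qed

sublocale gauss_channel T l opt_kernel
  using T l_pos opt_kernel_in_kernels by unfold_locales

lemma opt_channel_law: "Q = density (src \<Otimes>\<^sub>M out) (\<lambda>x. ennreal (exp (info (fst x) (snd x))))"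
proof (rule measure_eqI)
  show s: "sets Q = sets (density (src \<Otimes>\<^sub>M out) (\<lambda>x. ennreal (exp (info (fst x) (snd x)))))"
    unfolding sets_Q sets_density by (intro sets_pair_measure_cong) auto
  fix A assume "A \<in> sets Q"
  then have [measurable]: "A \<in> sets (borel \<Otimes>\<^sub>M borel)" by simp
  have "emeasure Q A = (\<integral>\<^sup>+ x. indicator A x \<partial>Q)" by simp
  also have "\<dots> = (\<integral>\<^sup>+ y. \<integral>\<^sup>+ z. indicator A (y, z) \<partial>opt_kernel y \<partial>src)"
    unfolding src_def by (rule nn_integral_channel_law[OF P_prob _ K]) auto
  also have "\<dots> = (\<integral>\<^sup>+ y. \<integral>\<^sup>+ z. ennreal (exp (info y z)) * indicator A (y, z) \<partial>out \<partial>src)"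
    unfolding opt_kernel_def by (intro nn_integral_cong nn_integral_density) auto
  also have "\<dots> = (\<integral>\<^sup>+ x. ennreal (exp (info (fst x) (snd x))) * indicator A x \<partial>(src \<Otimes>\<^sub>M out))"
    by (subst out.nn_integral_fst[symmetric]) auto
  also have "\<dots> = emeasure (density (src \<Otimes>\<^sub>M out) (\<lambda>x. ennreal (exp (info (fst x) (snd x))))) A"
    by (rule emeasure_density[symmetric]) auto
  finally show "emeasure Q A = emeasure (density (src \<Otimes>\<^sub>M out) (\<lambda>x. ennreal (exp (info (fst x) (snd x))))) A" .
qed

lemma nn_integral_opt_channel:
  assumes [measurable]: "F \<in> borel_measurable (borel \<Otimes>\<^sub>M borel)"
  shows "(\<integral>\<^sup>+ x. F x \<partial>Q) = (\<integral>\<^sup>+ z. \<integral>\<^sup>+ y. ennreal (exp (info y z)) * F (y, z) \<partial>src \<partial>out)"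
proof -
  have "(\<integral>\<^sup>+ x. F x \<partial>Q) = (\<integral>\<^sup>+ x. ennreal (exp (info (fst x) (snd x))) * F x \<partial>(src \<Otimes>\<^sub>M out))"
    unfolding opt_channel_law by (rule nn_integral_density) auto
  also have "\<dots> = (\<integral>\<^sup>+ z. \<integral>\<^sup>+ y. ennreal (exp (info y z)) * F (y, z) \<partial>src \<partial>out)"
    by (subst pair.nn_integral_snd[symmetric]) auto
  finally show ?thesis .
qed

text \<open>Mutual information refers to the actual output marginal. Because that marginal is
  \<open>out\<close>, the density of the joint law with respect to \<open>out\<close> gives the
  information density.\<close>

lemma distr_opt_channel_snd: "distr Q borel snd = out"
proof (rule measure_eqI)
  fix A assume "A \<in> sets (distr Q borel snd)"
  then have A [measurable]: "A \<in> sets borel" by simp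
  have "emeasure (distr Q borel snd) A = (\<integral>\<^sup>+ z. indicator A z \<partial>distr Q borel snd)" by simp
  also have "\<dots> = (\<integral>\<^sup>+ x. indicator A (snd x) \<partial>Q)" by (rule nn_integral_distr) auto
  also have "\<dots> = (\<integral>\<^sup>+ z. \<integral>\<^sup>+ y. ennreal (exp (info y z)) * indicator A z \<partial>src \<partial>out)"
    by (subst nn_integral_opt_channel) auto
  also have "\<dots> = (\<integral>\<^sup>+ z. (\<integral>\<^sup>+ y. ennreal (exp (info y z)) \<partial>src) * indicator A z \<partial>out)"
    by (intro nn_integral_cong nn_integral_multc) auto
  also have "\<dots> = (\<integral>\<^sup>+ z. indicator A z \<partial>out)"
    unfolding out_def
    by (subst (1 2) nn_integral_gauss_law[OF T]) (auto simp: nn_integral_exp_info_src)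
  finally show "emeasure (distr Q borel snd) A = emeasure out A" by simp
qed simp

lemma opt_kernel_distortion: "channel_distortion src opt_kernel = ennreal (\<Sum>i\<in>UNIV. min \<delta> (l i))"
proof -
  have "channel_distortion src opt_kernel = (\<integral>\<^sup>+ x. ennreal ((norm (fst x - snd x))\<^sup>2) \<partial>Q)"
    by (simp add: channel_distortion_def src_def case_prod_unfold)
  also have "\<dots> = (\<integral>\<^sup>+ z. \<integral>\<^sup>+ y. (\<Sum>i\<in>UNIV. ennreal (exp (info y z)) * ennreal ((T y $ i - T z $ i)\<^sup>2)) \<partial>src \<partial>out)"
    by (subst nn_integral_opt_channel) (auto simp: norm_diff_eq_sum_coords[OF T] sum_distrib_left[symmetric])
  also have "\<dots> = (\<integral>\<^sup>+ z. (\<Sum>i\<in>UNIV. \<integral>\<^sup>+ y. ennreal (exp (info y z)) * ennreal ((T y $ i - T z $ i)\<^sup>2) \<partial>src) \<partial>out)"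
    by (intro nn_integral_cong nn_integral_sum) auto
  also have "\<dots> = (\<integral>\<^sup>+ v. (\<Sum>i\<in>UNIV. ennreal (min \<delta> (l i))) \<partial>(\<Pi>\<^sub>M j\<in>(UNIV::'m set). std_normal))"
    unfolding out_def
    by (subst nn_integral_gauss_law[OF T]) (auto simp: T_inv[OF T] nn_integral_exp_info_src_square)
  also have "\<dots> = ennreal (\<Sum>i\<in>UNIV. min \<delta> (l i))"
    using prob_space.emeasure_space_1[OF prob_space_PiM_std_normal[of "UNIV :: 'm set"]] \<delta>_pos l_pos
    by (simp add: sum_ennreal less_imp_le)
  finally show ?thesis .
qed

text \<open>Here the Donsker-Varadhan bound is an equality: the entropy density is
  \<open>info / ln 2\<close> itself, and its mean depends only on the sum of the errors, known from
  the distortion.\<close>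

lemma opt_kernel_rate: "channel_rate src opt_kernel = ereal R"
proof -
  let ?f = "\<lambda>x. exp (info (fst x) (snd x))"
  let ?PP = "src \<Otimes>\<^sub>M out"
  have fin: "(\<integral>\<^sup>+ (y, z). ennreal ((norm (y - z))\<^sup>2) \<partial>Q) < \<infinity>"
    using opt_kernel_distortion by (simp add: channel_distortion_def src_def)
  have fst: "distr Q borel fst = src"
    unfolding src_def by (rule distr_channel_law_fst[OF P_prob _ K]) simp
  have id: "distr Q (borel \<Otimes>\<^sub>M borel) (\<lambda>\<omega>. \<omega>) = Q" by (rule distr_id2) simp
  have ac: "absolutely_continuous ?PP Q"
    unfolding opt_channel_law by (rule absolutely_continuousI_density) auto
  \<comment> \<open>\<open>RN_deriv\<close> is determined only almost everywhere under the product
    measure; absolute continuity carries the identity over to \<open>Q\<close>.\<close>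
  have ent: "AE x in Q. entropy_density 2 ?PP Q x = info (fst x) (snd x) / ln 2"
  proof (rule absolutely_continuous_AE[OF _ ac])
    show "sets Q = sets ?PP" unfolding opt_channel_law by simp
    have "AE x in ?PP. ennreal (?f x) = RN_deriv ?PP Q x"
      by (rule pair.P.RN_deriv_unique) (auto simp: opt_channel_law)
    then show "AE x in ?PP. entropy_density 2 ?PP Q x = info (fst x) (snd x) / ln 2"
    proof eventually_elim
      fix x assume "ennreal (?f x) = RN_deriv ?PP Q x"
      then show "entropy_density 2 ?PP Q x = info (fst x) (snd x) / ln 2"
        by (simp add: entropy_density_def log_def flip: \<open>ennreal (?f x) = RN_deriv ?PP Q x\<close>)
    qed
  qed
  have "has_bochner_integral Q (\<lambda>x. info (fst x) (snd x))
      (\<Sum>i\<in>UNIV. ln (max \<delta> (l i) / \<delta>) / 2 - err (\<lambda>z. z) i / (2 * \<delta>) + l i / (2 * max \<delta> (l i)))"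
    unfolding info_def by (rule has_bochner_integral_info[OF _ fin]) simp
  also have "(\<Sum>i\<in>UNIV. ln (max \<delta> (l i) / \<delta>) / 2 - err (\<lambda>z. z) i / (2 * \<delta>) + l i / (2 * max \<delta> (l i))) = R * ln 2"
  proof -
    have "ennreal (\<Sum>i\<in>UNIV. err (\<lambda>z. z) i) = ennreal (\<Sum>i\<in>UNIV. min \<delta> (l i))"
      using distortion_eq_sum_err[OF _ fin] opt_kernel_distortion by (simp add: channel_distortion_def src_def)
    then have "(\<Sum>i\<in>UNIV. err (\<lambda>z. z) i) = (\<Sum>i\<in>UNIV. min \<delta> (l i))"
      using \<delta>_pos l_pos by (subst (asm) ennreal_inj) (auto intro!: sum_nonneg err_nonneg simp: less_imp_le)
    moreover have "(\<Sum>i\<in>UNIV. l i / (2 * max \<delta> (l i))) = (\<Sum>i\<in>UNIV. min \<delta> (l i)) / (2 * \<delta>)"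
      by (rule sum_ratio_max) (use l_pos \<delta>_pos in auto)
    ultimately show ?thesis
      using level by (simp add: sum.distrib sum_subtractf sum_divide_distrib[symmetric])
  qed
  finally have "has_bochner_integral Q (\<lambda>x. info (fst x) (snd x) / ln 2) (R * ln 2 / ln 2)"
    by (rule has_bochner_integral_divide)
  then have I: "has_bochner_integral Q (\<lambda>x. info (fst x) (snd x) / ln 2) R" by simp
  have [measurable]: "entropy_density 2 ?PP Q \<in> borel_measurable Q"
    using measurable_entropy_density[of 2 ?PP Q] unfolding opt_channel_law by simp
  have "has_bochner_integral Q (entropy_density 2 ?PP Q) R"
    using I ent by (subst has_bochner_integral_cong_AE) auto
  moreover have "channel_rate src opt_kernel = Q.ext_mutual_information 2 borel borel fst snd"
    by (simp add: channel_rate_def src_def)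
  ultimately show ?thesis
    using ac unfolding Q.ext_mutual_information_def Q.mutual_information_def KL_divergence_def
    by (simp add: fst id distr_opt_channel_snd has_bochner_integral_iff)
qed

lemma distortion_rate_eq: "distortion_rate src R = ennreal (\<Sum>i\<in>UNIV. min \<delta> (l i))"
  unfolding distortion_rate_def
proof (rule antisym)
  show "(INF K\<in>{K \<in> kernels. channel_rate src K \<le> ereal R}. channel_distortion src K) \<le> ennreal (\<Sum>i\<in>UNIV. min \<delta> (l i))"
    by (rule INF_lower2[of opt_kernel]) (auto simp: opt_kernel_in_kernels opt_kernel_rate opt_kernel_distortion)
  show "ennreal (\<Sum>i\<in>UNIV. min \<delta> (l i)) \<le> (INF K\<in>{K \<in> kernels. channel_rate src K \<le> ereal R}. channel_distortion src K)"
  proof (rule INF_greatest)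
    fix K assume K: "K \<in> {K \<in> kernels. channel_rate src K \<le> ereal R}"
    interpret K: waterfilling T l K \<delta> R
      using T l_pos K \<delta>_pos level by unfold_locales (auto simp: src_def)
    show "ennreal (\<Sum>i\<in>UNIV. min \<delta> (l i)) \<le> channel_distortion src K"
      using K.distortion_lower_bound[of "\<lambda>z. z"] by (simp add: channel_distortion_def src_def)
  qed
qed

lemma rd_achieving_opt_kernel: "rd_achieving src R opt_kernel"
  by (simp add: rd_achieving_def opt_kernel_in_kernels opt_kernel_rate opt_kernel_distortion distortion_rate_eq)

lemma rd_achieving_iff:
  "rd_achieving src R K \<longleftrightarrow> K \<in> kernels \<and> channel_rate src K \<le> ereal R \<and>
    channel_distortion src K = ennreal (\<Sum>i\<in>UNIV. min \<delta> (l i))"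
  by (simp add: rd_achieving_def distortion_rate_eq)

end

section \<open>Density of a Gaussian vector\<close>

text \<open>Rectangles determine a product measure, and the indicator of a rectangle is itself a
  product, so the integral factorises.\<close>

lemma density_PiM:
  assumes "finite I" and f [measurable]: "\<And>i. i \<in> I \<Longrightarrow> f i \<in> borel_measurable (M i)"
    and "\<And>i. sigma_finite_measure (M i)" and "\<And>i. sigma_finite_measure (density (M i) (f i))"
  shows "PiM I (\<lambda>i. density (M i) (f i)) = density (PiM I M) (\<lambda>x. \<Prod>i\<in>I. f i (x i))"
proof -
  interpret M: product_sigma_finite M using assms(3) by (rule product_sigma_finite.intro)
  interpret D: product_sigma_finite "\<lambda>i. density (M i) (f i)"
    using assms(4) by (rule product_sigma_finite.intro)
  show ?thesis
  proof (rule D.PiM_eqI[OF \<open>finite I\<close>, symmetric])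
    show "sets (density (PiM I M) (\<lambda>x. \<Prod>i\<in>I. f i (x i))) = sets (PiM I (\<lambda>i. density (M i) (f i)))"
      unfolding sets_density by (intro sets_PiM_cong) auto
    fix A assume A: "\<And>i. i \<in> I \<Longrightarrow> A i \<in> sets (density (M i) (f i))"
    then have A' [measurable]: "\<And>i. i \<in> I \<Longrightarrow> A i \<in> sets (M i)" by simp
    have [measurable]: "Pi\<^sub>E I A \<in> sets (PiM I M)" using A' \<open>finite I\<close> by (rule sets_PiM_I_finite[rotated])
    have "emeasure (density (PiM I M) (\<lambda>x. \<Prod>i\<in>I. f i (x i))) (Pi\<^sub>E I A) =
        (\<integral>\<^sup>+ x. (\<Prod>i\<in>I. f i (x i)) * indicator (Pi\<^sub>E I A) x \<partial>PiM I M)"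
      using \<open>finite I\<close> by (subst emeasure_density) auto
    also have "\<dots> = (\<integral>\<^sup>+ x. (\<Prod>i\<in>I. f i (x i) * indicator (A i) (x i)) \<partial>PiM I M)"
    proof (rule nn_integral_cong)
      fix x assume x: "x \<in> space (PiM I M)"
      show "(\<Prod>i\<in>I. f i (x i)) * indicator (Pi\<^sub>E I A) x = (\<Prod>i\<in>I. f i (x i) * indicator (A i) (x i))"
      proof (cases "x \<in> Pi\<^sub>E I A")
        case True
        then show ?thesis by (auto intro!: prod.cong simp: PiE_iff)
      next
        case False
        then obtain i where "i \<in> I" "x i \<notin> A i" using x by (auto simp: PiE_iff space_PiM)
        then have "(\<Prod>i\<in>I. f i (x i) * indicator (A i) (x i)) = 0"
          using \<open>finite I\<close> by (intro prod_zero bexI[of _ i]) auto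
        then show ?thesis using False by simp
      qed
    qed
    also have "\<dots> = (\<Prod>i\<in>I. \<integral>\<^sup>+ x. f i x * indicator (A i) x \<partial>M i)"
      by (rule M.product_nn_integral_prod[OF \<open>finite I\<close>]) auto
    also have "\<dots> = (\<Prod>i\<in>I. emeasure (density (M i) (f i)) (A i))"
      by (intro prod.cong refl) (simp add: emeasure_density)
    finally show "emeasure (density (PiM I M) (\<lambda>x. \<Prod>i\<in>I. f i (x i))) (Pi\<^sub>E I A) =
        (\<Prod>i\<in>I. emeasure (density (M i) (f i)) (A i))" .
  qed
qed

lemma distr_PiM_std_normal_scale:
  fixes \<sigma> :: "'i::finite \<Rightarrow> real"
  assumes "\<And>i. 0 < \<sigma> i"
  shows "distr (\<Pi>\<^sub>M i\<in>UNIV. std_normal) (\<Pi>\<^sub>M i\<in>UNIV. borel) (\<lambda>v i. \<sigma> i * v i) =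
    (\<Pi>\<^sub>M i\<in>UNIV. density lborel (normal_density 0 (\<sigma> i)))"
proof -
  interpret N: product_sigma_finite "\<lambda>_::'i. std_normal"
    by (intro product_sigma_finite.intro prob_space_imp_sigma_finite prob_space_std_normal)
  interpret D: product_sigma_finite "\<lambda>i. density lborel (normal_density 0 (\<sigma> i))"
    using assms by (intro product_sigma_finite.intro prob_space_imp_sigma_finite prob_space_normal_density)
  have m: "(\<lambda>v i. \<sigma> i * v i) \<in> (\<Pi>\<^sub>M i\<in>UNIV. std_normal) \<rightarrow>\<^sub>M (\<Pi>\<^sub>M i\<in>UNIV. borel)"
    by (rule measurable_PiM_single') (auto simp: measurable_component_singleton)
  show ?thesis
  proof (rule D.PiM_eqI)
    show "sets (distr (\<Pi>\<^sub>M i\<in>UNIV. std_normal) (\<Pi>\<^sub>M i\<in>UNIV. borel) (\<lambda>v i. \<sigma> i * v i)) =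
        sets (\<Pi>\<^sub>M i\<in>UNIV. density lborel (normal_density 0 (\<sigma> i)))"
      unfolding sets_distr by (intro sets_PiM_cong) auto
    fix A assume "\<And>i. i \<in> UNIV \<Longrightarrow> A i \<in> sets (density lborel (normal_density 0 (\<sigma> i)))"
    then have A [measurable]: "\<And>i. A i \<in> sets borel" by simp
    have 1: "Pi\<^sub>E UNIV A \<in> sets (\<Pi>\<^sub>M i\<in>UNIV. borel)" using A by (intro sets_PiM_I_finite) auto
    have "emeasure (distr (\<Pi>\<^sub>M i\<in>UNIV. std_normal) (\<Pi>\<^sub>M i\<in>UNIV. borel) (\<lambda>v i. \<sigma> i * v i)) (Pi\<^sub>E UNIV A) =
        emeasure (\<Pi>\<^sub>M i\<in>UNIV. std_normal) (Pi\<^sub>E UNIV (\<lambda>i. (\<lambda>w. \<sigma> i * w) -` A i))"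
      by (subst emeasure_distr[OF m 1]) (auto intro!: arg_cong2[where f=emeasure] simp: space_PiM PiE_iff)
    also have "\<dots> = (\<Prod>i\<in>UNIV. emeasure std_normal ((\<lambda>w. \<sigma> i * w) -` A i))"
    proof (rule N.emeasure_PiM)
      have "(\<lambda>w. \<sigma> i * w) \<in> std_normal \<rightarrow>\<^sub>M borel" for i by measurable
      from measurable_sets[OF this A]
      show "(\<lambda>w. \<sigma> i * w) -` A i \<in> sets std_normal" for i by simp
    qed auto
    also have "\<dots> = (\<Prod>i\<in>UNIV. emeasure (density lborel (normal_density 0 (\<sigma> i))) (A i))"
      using assms distr_std_normal_affine[of _ 0]
      by (intro prod.cong refl) (simp add: emeasure_distr flip: distr_std_normal_affine[of _ 0])
    finally show "emeasure (distr (\<Pi>\<^sub>M i\<in>UNIV. std_normal) (\<Pi>\<^sub>M i\<in>UNIV. borel) (\<lambda>v i. \<sigma> i * v i)) (Pi\<^sub>E UNIV A) =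
        (\<Prod>i\<in>UNIV. emeasure (density lborel (normal_density 0 (\<sigma> i))) (A i))" .
  qed simp
qed

lemma distr_PiM_lborel_vec:
  "distr (\<Pi>\<^sub>M i\<in>(UNIV::'m::finite set). lborel) borel (\<lambda>v. \<chi> i. v i) = (lborel :: (real ^ 'm) measure)"
proof (rule lborel_eqI[symmetric])
  interpret product_sigma_finite "\<lambda>_::'m. lborel :: real measure" ..
  fix lo up :: "real ^ 'm" assume le: "\<And>b. b \<in> Basis \<Longrightarrow> lo \<bullet> b \<le> up \<bullet> b"
  have B: "Basis = range (\<lambda>i::'m. axis i (1::real))" by (auto simp: Basis_vec_def)
  have le': "lo $ i \<le> up $ i" for i
    using le[of "axis i 1"] by (auto simp: inner_axis B)
  have "emeasure (distr (\<Pi>\<^sub>M i\<in>(UNIV::'m set). lborel) borel (\<lambda>v. \<chi> i. v i)) (box lo up) =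
      emeasure (\<Pi>\<^sub>M i\<in>(UNIV::'m set). lborel) (Pi\<^sub>E UNIV (\<lambda>i. {lo $ i <..< up $ i}))"
    by (subst emeasure_distr) (auto intro!: arg_cong2[where f=emeasure] simp: space_PiM PiE_iff mem_box_cart)
  also have "\<dots> = (\<Prod>i\<in>UNIV. emeasure lborel {lo $ i <..< up $ i})"
    by (rule emeasure_PiM) auto
  also have "\<dots> = (\<Prod>i\<in>UNIV. (up - lo) $ i)"
    using le' by (simp add: prod_ennreal)
  also have "(\<Prod>i\<in>UNIV. (up - lo) $ i) = (\<Prod>b\<in>Basis. (up - lo) \<bullet> b)"
    unfolding B by (subst prod.reindex) (auto simp: inner_axis inj_on_def axis_eq_axis)
  finally show "emeasure (distr (\<Pi>\<^sub>M i\<in>(UNIV::'m set). lborel) borel (\<lambda>v. \<chi> i. v i)) (box lo up) =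
      (\<Prod>b\<in>Basis. (up - lo) \<bullet> b)" .
qed simp

lemma nn_integral_lborel_translate:
  fixes f :: "'a::euclidean_space \<Rightarrow> ennreal"
  assumes [measurable]: "f \<in> borel_measurable borel"
  shows "(\<integral>\<^sup>+ x. f (c + x) \<partial>lborel) = (\<integral>\<^sup>+ x. f x \<partial>lborel)"
proof -
  have "(\<integral>\<^sup>+ x. f x \<partial>lborel) = (\<integral>\<^sup>+ x. f x \<partial>distr lborel borel ((+) c))"
    by (simp add: lborel_distr_plus)
  also have "\<dots> = (\<integral>\<^sup>+ x. f (c + x) \<partial>lborel)" by (rule nn_integral_distr) auto
  finally show ?thesis by simp
qed

text \<open>Uniqueness of Haar measure: Fubini and translation invariance give
  \<open>\<mu>(f) \<lambda>(g) = \<mu>(g) \<lambda>(f)\<close> for the image \<open>\<mu>\<close> of Lebesgue measure \<open>\<lambda>\<close> and even \<open>f\<close>; then take for \<open>f\<close> the indicator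
  of the unit ball. (The library has the invariance only for well-ordered index types.)\<close>

lemma nn_integral_lborel_orthogonal:
  fixes S :: "'a::euclidean_space \<Rightarrow> 'a" and g :: "'a \<Rightarrow> ennreal"
  assumes S: "orthogonal_transformation S" and g [measurable]: "g \<in> borel_measurable borel"
  shows "(\<integral>\<^sup>+ x. g (S x) \<partial>lborel) = (\<integral>\<^sup>+ x. g x \<partial>lborel)"
proof -
  have [measurable]: "S \<in> borel_measurable borel" by (rule borel_measurable_orthogonal[OF S])
  define f :: "'a \<Rightarrow> ennreal" where "f = indicator (ball 0 1)"
  have [measurable]: "f \<in> borel_measurable borel" unfolding f_def by (rule borel_measurable_indicator) simp
  have f_S: "f (S x) = f x" for x
    using S by (simp add: f_def indicator_def orthogonal_transformation_norm)
  \<comment> \<open>Evenness of \<open>f\<close> turns the reflection \<open>y\<close> to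
    \<open>x - y\<close> into a translation, so invariance under translations suffices.\<close>
  have f_diff: "f (x - y) = f (- x + y)" for x y
    by (simp add: f_def indicator_def norm_minus_commute add.commute[of "- x"])
  have f_refl: "(\<integral>\<^sup>+ y. f (x - y) \<partial>lborel) = (\<integral>\<^sup>+ y. f y \<partial>lborel)" for x
    unfolding f_diff by (rule nn_integral_lborel_translate) measurable
  have f_int: "(\<integral>\<^sup>+ x. f x \<partial>lborel) = emeasure lborel (ball (0::'a) 1)"
    unfolding f_def by simp
  have S_shift: "S (- inv S y + x) = S x - y" for x y
    using orthogonal_transformation_bij[OF S] orthogonal_transformation_linear[OF S]
    by (simp add: linear_add linear_neg linear_diff bij_is_surj surj_f_inv_f)
  have "(\<integral>\<^sup>+ x. f x \<partial>lborel) * (\<integral>\<^sup>+ y. g y \<partial>lborel) = (\<integral>\<^sup>+ x. \<integral>\<^sup>+ y. f (S x) * g (S x + y) \<partial>lborel \<partial>lborel)"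
    by (simp add: nn_integral_cmult nn_integral_multc nn_integral_lborel_translate f_S)
  also have "\<dots> = (\<integral>\<^sup>+ y. \<integral>\<^sup>+ x. f (S x) * g (S x + y) \<partial>lborel \<partial>lborel)"
    by (rule lborel_pair.Fubini') measurable
  also have "\<dots> = (\<integral>\<^sup>+ y. \<integral>\<^sup>+ x. f (S x - y) * g (S x) \<partial>lborel \<partial>lborel)"
  proof (rule nn_integral_cong)
    fix y
    show "(\<integral>\<^sup>+ x. f (S x) * g (S x + y) \<partial>lborel) = (\<integral>\<^sup>+ x. f (S x - y) * g (S x) \<partial>lborel)"
    proof -
      have "(\<lambda>x. f (S x) * g (S x + y)) \<in> borel_measurable borel" by measurable
      from nn_integral_lborel_translate[OF this, of "- inv S y"] show ?thesis
        by (simp only: S_shift diff_add_cancel)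
    qed
  qed
  also have "\<dots> = (\<integral>\<^sup>+ x. \<integral>\<^sup>+ y. f (S x - y) * g (S x) \<partial>lborel \<partial>lborel)"
    by (rule lborel_pair.Fubini') measurable
  also have "\<dots> = (\<integral>\<^sup>+ x. f x \<partial>lborel) * (\<integral>\<^sup>+ x. g (S x) \<partial>lborel)"
    by (simp add: nn_integral_cmult nn_integral_multc f_refl)
  finally have "(\<integral>\<^sup>+ x. f x \<partial>lborel) * (\<integral>\<^sup>+ y. g y \<partial>lborel) =
      (\<integral>\<^sup>+ x. f x \<partial>lborel) * (\<integral>\<^sup>+ x. g (S x) \<partial>lborel)" .
  moreover have "emeasure lborel (ball (0::'a) 1) \<noteq> \<infinity>"
    using emeasure_bounded_finite[of "ball (0::'a) 1"] by simp
  moreover have "emeasure lborel (ball (0::'a) 1) \<noteq> 0"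
  proof
    assume "emeasure lborel (ball (0::'a) 1) = 0"
    then have "ball (0::'a) 1 \<in> null_sets lborel" by (intro null_setsI) auto
    then have "negligible (ball (0::'a) 1)"
      by (simp add: negligible_iff_null_sets null_sets_completionI)
    then show False using open_not_negligible[of "ball (0::'a) 1"] by simp
  qed
  ultimately show ?thesis
    unfolding f_int ennreal_mult_cancel_left by auto
qed

lemma distr_lborel_orthogonal:
  fixes S :: "'a::euclidean_space \<Rightarrow> 'a"
  assumes S: "orthogonal_transformation S"
  shows "distr lborel borel S = lborel"
proof (rule measure_eqI)
  have [measurable]: "S \<in> borel_measurable borel" by (rule borel_measurable_orthogonal[OF S])
  fix A assume "A \<in> sets (distr lborel borel S)"
  then have [measurable]: "A \<in> sets borel" by simp
  have "emeasure (distr lborel borel S) A = (\<integral>\<^sup>+ x. indicator A x \<partial>distr lborel borel S)" by simp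
  also have "\<dots> = (\<integral>\<^sup>+ x. indicator A (S x) \<partial>lborel)" by (rule nn_integral_distr) auto
  also have "\<dots> = emeasure lborel A" by (subst nn_integral_lborel_orthogonal[OF S]) auto
  finally show "emeasure (distr lborel borel S) A = emeasure lborel A" .
qed simp

text \<open>Needed to exchange the order in which \<theta> and \<open>Y\<close> are drawn, which is
  done by Fubini on joint densities. Rotation invariance of Lebesgue measure removes
  \<open>inv T\<close>.\<close>

lemma gauss_law_density:
  fixes T :: "real ^ 'm::finite \<Rightarrow> real ^ 'm"
  assumes T: "orthogonal_transformation T" and \<sigma>: "\<And>i. 0 < \<sigma> i"
  shows "gauss_law T \<sigma> = density lborel (\<lambda>y. \<Prod>i\<in>UNIV. ennreal (normal_density 0 (\<sigma> i) (T y $ i)))"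
proof -
  let ?g = "\<lambda>y. \<Prod>i\<in>UNIV. ennreal (normal_density 0 (\<sigma> i) (T y $ i))"
  let ?L = "\<Pi>\<^sub>M i\<in>(UNIV::'m set). (lborel :: real measure)"
  have [measurable]: "T \<in> borel_measurable borel" "inv T \<in> borel_measurable borel" by (rule borel_measurable_T[OF T])+
  have c: "(\<lambda>v. (\<chi> i. v i) :: real ^ 'm) \<in> (\<Pi>\<^sub>M i\<in>UNIV. borel) \<rightarrow>\<^sub>M borel" by measurable
  have c': "(\<lambda>v. (\<chi> i. v i) :: real ^ 'm) \<in> ?L \<rightarrow>\<^sub>M borel" by measurable
  have m: "(\<lambda>v i. \<sigma> i * v i) \<in> (\<Pi>\<^sub>M i\<in>UNIV. std_normal) \<rightarrow>\<^sub>M (\<Pi>\<^sub>M i\<in>UNIV. borel)"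
    by (rule measurable_PiM_single') (auto simp: measurable_component_singleton)
  have "gauss_law T \<sigma> = distr (distr (\<Pi>\<^sub>M j\<in>UNIV. std_normal) (\<Pi>\<^sub>M i\<in>UNIV. borel) (\<lambda>v i. \<sigma> i * v i)) borel (inv T \<circ> (\<lambda>v. \<chi> i. v i))"
    unfolding gauss_law_def by (subst distr_distr[OF measurable_comp[OF c] m]) (auto simp: o_def)
  also have "\<dots> = distr (density ?L (\<lambda>v. \<Prod>i\<in>UNIV. ennreal (normal_density 0 (\<sigma> i) (v i)))) borel (inv T \<circ> (\<lambda>v. \<chi> i. v i))"
    unfolding distr_PiM_std_normal_scale[OF \<sigma>]
    by (subst density_PiM) (auto intro!: prob_space_imp_sigma_finite prob_space_normal_density \<sigma> lborel.sigma_finite_measure_axioms)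
  \<comment> \<open>The density depends on \<open>v\<close> only through its image, so it can be
    moved outside \<open>distr\<close>.\<close>
  also have "(\<lambda>v. \<Prod>i\<in>UNIV. ennreal (normal_density 0 (\<sigma> i) (v i))) = ?g \<circ> (inv T \<circ> (\<lambda>v. \<chi> i. v i))"
    by (simp add: o_def T_inv[OF T])
  also have "distr (density ?L (?g \<circ> (inv T \<circ> (\<lambda>v. \<chi> i. v i)))) borel (inv T \<circ> (\<lambda>v. \<chi> i. v i)) =
      density (distr ?L borel (inv T \<circ> (\<lambda>v. \<chi> i. v i))) ?g"
    by (subst density_distr) (auto simp: o_def intro!: measurable_compose[OF c'])
  also have "distr ?L borel (inv T \<circ> (\<lambda>v. \<chi> i. v i)) = lborel"
  proof -
    have "distr ?L borel (inv T \<circ> (\<lambda>v. \<chi> i. v i)) = distr (distr ?L borel (\<lambda>v. \<chi> i. v i)) borel (inv T)"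
      by (rule distr_distr[symmetric]) measurable
    then show ?thesis
      by (simp only: distr_PiM_lborel_vec distr_lborel_orthogonal[OF orthogonal_transformation_inv[OF T]])
  qed
  finally show ?thesis .
qed

section \<open>Source and observation\<close>

lemma prod_normal_density:
  fixes x :: "'i::finite \<Rightarrow> real"
  assumes "\<And>i. 0 < \<sigma> i"
  shows "(\<Prod>i\<in>UNIV. normal_density 0 (\<sigma> i) (x i)) =
    (1 / sqrt (2 * pi)) ^ CARD('i) / (\<Prod>i\<in>UNIV. \<sigma> i) * exp (- (\<Sum>i\<in>UNIV. (x i)\<^sup>2 / (\<sigma> i)\<^sup>2) / 2)"
proof -
  have "normal_density 0 (\<sigma> i) (x i) = (1 / sqrt (2 * pi)) / \<sigma> i * exp (- ((x i)\<^sup>2 / (\<sigma> i)\<^sup>2) / 2)" for i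
    using assms[of i] by (simp add: normal_density_def real_sqrt_mult)
  then show ?thesis
    by (simp add: prod.distrib prod_dividef exp_sum[symmetric] sum_negf sum_divide_distrib power_divide)
qed

locale observation =
  fixes a :: "real ^ 'm::finite" and T :: "real ^ 'm \<Rightarrow> real ^ 'm" and k :: 'm and s :: real
  assumes T: "orthogonal_transformation T" and Ta: "T a = s *\<^sub>R axis k 1"
begin

text \<open>The standard deviation of the observation in the direction of \<open>a\<close>: signal
  variance \<open>s^2\<close> plus noise variance 1. In the other rotated directions only the noise
  remains.\<close>

definition "r = sqrt (1 + s\<^sup>2)"
definition "sd i = (if i = k then r else 1)"

lemma r_pos: "0 < r" and r_sq: "r\<^sup>2 = 1 + s\<^sup>2"
  by (simp_all add: r_def add_pos_nonneg)

lemma sd_pos: "0 < sd i" using r_pos by (simp add: sd_def)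

lemma inner_a: "a \<bullet> y = s * T y $ k"
proof -
  have "a \<bullet> y = T a \<bullet> T y" using T by (simp add: orthogonal_transformation_def)
  then show ?thesis by (simp add: Ta inner_axis inner_commute[of "axis k 1"])
qed

lemma norm_a: "(norm a)\<^sup>2 = s\<^sup>2"
proof -
  have "norm a = norm (T a)" using T by (simp add: orthogonal_transformation_norm)
  then show ?thesis by (simp add: Ta)
qed

text \<open>Both sides are the joint density of \<open>(\<theta>, Y)\<close>, disintegrated along \<open>\<theta>\<close> and along \<open>Y\<close>.\<close>

lemma normal_density_disintegrate:
  "std_normal_density t * (\<Prod>i\<in>UNIV. std_normal_density ((y - t *\<^sub>R a) $ i)) =
   (\<Prod>i\<in>UNIV. normal_density 0 (sd i) (T y $ i)) * normal_density (s / r\<^sup>2 * T y $ k) (1 / r) t"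
proof -
  let ?C = "(1 / sqrt (2 * pi)) ^ CARD('m)" and ?Y = "T y $ k"
  have "(\<Sum>i\<in>UNIV. ((y - t *\<^sub>R a) $ i)\<^sup>2) = (norm (y - t *\<^sub>R a))\<^sup>2"
    by (simp add: norm_vec_def L2_set_def sum_nonneg)
  also have "\<dots> = (norm y)\<^sup>2 - 2 * t * (a \<bullet> y) + t\<^sup>2 * (norm a)\<^sup>2"
  proof -
    have "(y - t *\<^sub>R a) \<bullet> (y - t *\<^sub>R a) = y \<bullet> y - 2 * t * (a \<bullet> y) + t\<^sup>2 * (a \<bullet> a)"
      by (simp only: inner_diff_left inner_diff_right inner_scaleR_left inner_scaleR_right inner_commute[of y a])
         (simp add: algebra_simps power2_eq_square)
    then show ?thesis by (simp only: power2_norm_eq_inner)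
  qed
  finally have lhs: "(\<Sum>i\<in>UNIV. ((y - t *\<^sub>R a) $ i)\<^sup>2) = (norm y)\<^sup>2 - 2 * t * s * ?Y + t\<^sup>2 * s\<^sup>2"
    by (simp add: inner_a norm_a)
  have "(\<Sum>i\<in>UNIV. (T y $ i)\<^sup>2 / (sd i)\<^sup>2) = (\<Sum>i\<in>UNIV. (T y $ i)\<^sup>2 + (if i = k then ?Y\<^sup>2 / r\<^sup>2 - ?Y\<^sup>2 else 0))"
    by (intro sum.cong) (auto simp: sd_def)
  also have "\<dots> = (norm y)\<^sup>2 + (?Y\<^sup>2 / r\<^sup>2 - ?Y\<^sup>2)"
    by (simp add: sum.distrib norm_eq_sum_coords[OF T])
  finally have rhs: "(\<Sum>i\<in>UNIV. (T y $ i)\<^sup>2 / (sd i)\<^sup>2) = (norm y)\<^sup>2 + (?Y\<^sup>2 / r\<^sup>2 - ?Y\<^sup>2)" .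
  have sdp: "(\<Prod>i\<in>UNIV. sd i) = r" by (simp add: sd_def prod.delta)
  \<comment> \<open>Completing the square in \<open>t\<close>: \<open>r^2 = 1 + s^2\<close> is the
    posterior precision of \<theta>, and \<open>s / r^2 * ?Y\<close> its posterior mean.\<close>
  have e: "- t\<^sup>2 / 2 + - ((norm y)\<^sup>2 - 2 * t * s * ?Y + t\<^sup>2 * s\<^sup>2) / 2 =
      - ((norm y)\<^sup>2 + (?Y\<^sup>2 / r\<^sup>2 - ?Y\<^sup>2)) / 2 + - (r\<^sup>2 * (t - s / r\<^sup>2 * ?Y)\<^sup>2) / 2"
  proof -
    define q where "q = r\<^sup>2"
    have "s\<^sup>2 = q - 1" "q \<noteq> 0" using r_sq r_pos by (auto simp: q_def)
    have "q * (t - s / q * ?Y)\<^sup>2 = q * t\<^sup>2 - 2 * t * s * ?Y + s\<^sup>2 * ?Y\<^sup>2 / q"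
      using \<open>q \<noteq> 0\<close> by (simp add: field_simps power2_eq_square)
    also have "\<dots> = q * t\<^sup>2 - 2 * t * s * ?Y + ?Y\<^sup>2 - ?Y\<^sup>2 / q"
      using \<open>q \<noteq> 0\<close> by (simp add: \<open>s\<^sup>2 = q - 1\<close> field_simps)
    finally show ?thesis
      unfolding q_def[symmetric] \<open>s\<^sup>2 = q - 1\<close> by (simp add: field_simps)
  qed
  have "std_normal_density t * (\<Prod>i\<in>UNIV. std_normal_density ((y - t *\<^sub>R a) $ i)) =
      1 / sqrt (2 * pi) * ?C * (exp (- t\<^sup>2 / 2) * exp (- ((norm y)\<^sup>2 - 2 * t * s * ?Y + t\<^sup>2 * s\<^sup>2) / 2))"
    by (subst prod_normal_density) (simp_all add: std_normal_density_def lhs[simplified])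
  also have "\<dots> = 1 / sqrt (2 * pi) * ?C *
      (exp (- ((norm y)\<^sup>2 + (?Y\<^sup>2 / r\<^sup>2 - ?Y\<^sup>2)) / 2) * exp (- (r\<^sup>2 * (t - s / r\<^sup>2 * ?Y)\<^sup>2) / 2))"
    by (simp only: mult_exp_exp e)
  also have "\<dots> = (\<Prod>i\<in>UNIV. normal_density 0 (sd i) (T y $ i)) * normal_density (s / r\<^sup>2 * ?Y) (1 / r) t"
  proof -
    have "normal_density (s / r\<^sup>2 * ?Y) (1 / r) t = r / sqrt (2 * pi) * exp (- (r\<^sup>2 * (t - s / r\<^sup>2 * ?Y)\<^sup>2) / 2)"
      using r_pos by (simp add: normal_density_def real_sqrt_divide power_divide real_sqrt_mult)
    then show ?thesis
      using r_pos by (subst prod_normal_density[OF sd_pos]) (simp add: sdp rhs)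
  qed
  finally show ?thesis .
qed

lemma prob_space_source_obs_law: "prob_space (source_obs_law a)"
  and sets_source_obs_law [simp, measurable_cong]: "sets (source_obs_law a) = sets (borel \<Otimes>\<^sub>M borel)"
proof -
  interpret N: pair_prob_space std_normal "\<Pi>\<^sub>M j\<in>(UNIV::'m set). std_normal"
    by (intro pair_prob_space.intro pair_sigma_finite.intro prob_space_imp_sigma_finite
        prob_space_std_normal prob_space_PiM_std_normal)
  show "prob_space (source_obs_law a)"
    unfolding source_obs_law_def by (rule N.P.prob_space_distr) measurable
qed (simp add: source_obs_law_def)

text \<open>The model draws \<theta> first; here \<open>Y\<close> is drawn first and \<theta> is its
  posterior mean plus noise independent of \<open>Y\<close>. In this form a kernel acting on
  \<open>Y\<close> can be inserted.\<close>

lemma nn_integral_source_obs_law: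
  assumes F [measurable]: "F \<in> borel_measurable (borel \<Otimes>\<^sub>M borel)"
  shows "(\<integral>\<^sup>+ x. F x \<partial>source_obs_law a) =
    (\<integral>\<^sup>+ y. \<integral>\<^sup>+ n. F (s / r\<^sup>2 * T y $ k + 1 / r * n, y) \<partial>std_normal \<partial>gauss_law T sd)"
proof -
  have [measurable]: "T \<in> borel_measurable borel" by (rule borel_measurable_T[OF T])
  interpret N: prob_space std_normal by (rule prob_space_std_normal)
  interpret V: prob_space "\<Pi>\<^sub>M j\<in>(UNIV::'m set). std_normal" by (rule prob_space_PiM_std_normal)
  let ?V = "\<Pi>\<^sub>M j\<in>(UNIV::'m set). std_normal"
  have id: "orthogonal_transformation (\<lambda>x::real ^ 'm. x)" by (simp add: orthogonal_transformation_def)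
  have inv_id: "inv (\<lambda>x::real ^ 'm. x) = (\<lambda>x. x)" by (rule inv_id[unfolded id_def])
  have chi: "(\<chi> j. a $ j * t + v j) = t *\<^sub>R a + (\<chi> i. 1 * v i)" for t and v :: "'m \<Rightarrow> real"
    by (simp add: vec_eq_iff)
  have "(\<integral>\<^sup>+ x. F x \<partial>source_obs_law a) =
      (\<integral>\<^sup>+ (t, v). F (t, \<chi> j. a $ j * t + v j) \<partial>(std_normal \<Otimes>\<^sub>M ?V))"
    unfolding source_obs_law_def by (subst nn_integral_distr) (auto simp: case_prod_unfold)
  also have "\<dots> = (\<integral>\<^sup>+ t. \<integral>\<^sup>+ v. F (t, \<chi> j. a $ j * t + v j) \<partial>?V \<partial>std_normal)"
    by (subst V.nn_integral_fst[symmetric]) auto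
  \<comment> \<open>The noise vector is the Gaussian law with identity rotation and unit
    deviations.\<close>
  also have "\<dots> = (\<integral>\<^sup>+ t. \<integral>\<^sup>+ x. F (t, t *\<^sub>R a + x) \<partial>gauss_law (\<lambda>x. x) (\<lambda>_. 1) \<partial>std_normal)"
    unfolding chi by (subst nn_integral_gauss_law[OF id]) (auto simp: inv_id)
  also have "\<dots> = (\<integral>\<^sup>+ t. \<integral>\<^sup>+ y. (\<Prod>i\<in>UNIV. ennreal (std_normal_density ((y - t *\<^sub>R a) $ i))) * F (t, y) \<partial>lborel \<partial>std_normal)"
  proof (rule nn_integral_cong)
    fix t
    let ?f = "\<lambda>y. (\<Prod>i\<in>UNIV. ennreal (std_normal_density ((y - t *\<^sub>R a) $ i))) * F (t, y)"
    have "(\<integral>\<^sup>+ x. F (t, t *\<^sub>R a + x) \<partial>gauss_law (\<lambda>x. x) (\<lambda>_. 1)) = (\<integral>\<^sup>+ x. ?f (t *\<^sub>R a + x) \<partial>lborel)"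
      by (subst gauss_law_density[OF id]) (auto simp: nn_integral_density)
    also have "\<dots> = (\<integral>\<^sup>+ y. ?f y \<partial>lborel)" by (rule nn_integral_lborel_translate) measurable
    finally show "(\<integral>\<^sup>+ x. F (t, t *\<^sub>R a + x) \<partial>gauss_law (\<lambda>x. x) (\<lambda>_. 1)) = (\<integral>\<^sup>+ y. ?f y \<partial>lborel)" .
  qed
  also have "\<dots> = (\<integral>\<^sup>+ t. \<integral>\<^sup>+ y. ennreal (std_normal_density t * (\<Prod>i\<in>UNIV. std_normal_density ((y - t *\<^sub>R a) $ i))) * F (t, y) \<partial>lborel \<partial>lborel)"
    unfolding std_normal_def
    by (subst nn_integral_density)
       (auto simp: nn_integral_cmult[symmetric] ennreal_mult prod_ennreal prod_nonneg mult.assoc)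
  also have "\<dots> = (\<integral>\<^sup>+ y. \<integral>\<^sup>+ t. ennreal (std_normal_density t * (\<Prod>i\<in>UNIV. std_normal_density ((y - t *\<^sub>R a) $ i))) * F (t, y) \<partial>lborel \<partial>lborel)"
    by (rule lborel_pair.Fubini') measurable
  also have "\<dots> = (\<integral>\<^sup>+ y. (\<Prod>i\<in>UNIV. ennreal (normal_density 0 (sd i) (T y $ i))) *
      (\<integral>\<^sup>+ n. F (s / r\<^sup>2 * T y $ k + 1 / r * n, y) \<partial>std_normal) \<partial>lborel)"
  proof (rule nn_integral_cong)
    fix y
    have "(\<integral>\<^sup>+ n. F (s / r\<^sup>2 * T y $ k + 1 / r * n, y) \<partial>std_normal) =
        (\<integral>\<^sup>+ t. ennreal (normal_density (s / r\<^sup>2 * T y $ k) (1 / r) t) * F (t, y) \<partial>lborel)"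
      using r_pos by (intro nn_integral_std_normal_affine[where F="\<lambda>t. F (t, y)"]) auto
    then show "(\<integral>\<^sup>+ t. ennreal (std_normal_density t * (\<Prod>i\<in>UNIV. std_normal_density ((y - t *\<^sub>R a) $ i))) * F (t, y) \<partial>lborel) =
        (\<Prod>i\<in>UNIV. ennreal (normal_density 0 (sd i) (T y $ i))) *
        (\<integral>\<^sup>+ n. F (s / r\<^sup>2 * T y $ k + 1 / r * n, y) \<partial>std_normal)"
      unfolding normal_density_disintegrate
      by (simp add: nn_integral_cmult[symmetric] ennreal_mult prod_ennreal prod_nonneg mult.assoc)
  qed
  also have "\<dots> = (\<integral>\<^sup>+ y. \<integral>\<^sup>+ n. F (s / r\<^sup>2 * T y $ k + 1 / r * n, y) \<partial>std_normal \<partial>gauss_law T sd)"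
    by (subst gauss_law_density[OF T sd_pos], subst nn_integral_density) auto
  finally show ?thesis .
qed

lemma obs_law_eq: "obs_law a = gauss_law T sd"
proof (rule measure_eqI)
  fix A assume "A \<in> sets (obs_law a)"
  then have [measurable]: "A \<in> sets borel" by (simp add: obs_law_def)
  have "emeasure (obs_law a) A = (\<integral>\<^sup>+ y. indicator A y \<partial>obs_law a)" by (simp add: obs_law_def)
  also have "\<dots> = (\<integral>\<^sup>+ x. indicator A (snd x) \<partial>source_obs_law a)"
    unfolding obs_law_def by (rule nn_integral_distr) auto
  also have "\<dots> = (\<integral>\<^sup>+ y. indicator A y \<partial>gauss_law T sd)"
    using prob_space.emeasure_space_1[OF prob_space_std_normal] by (subst nn_integral_source_obs_law) auto
  finally show "emeasure (obs_law a) A = emeasure (gauss_law T sd) A" by simp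
qed (simp add: obs_law_def)

end

section \<open>Bayes risk\<close>

text \<open>With all other samples frozen, component \<open>i\<close> of an estimator uses only the
  output of sample \<open>i\<close>. Since the samples are independent, joint estimation cannot beat
  \<rho>, and applying \<open>\<psi>0\<close> to each sample attains it.\<close>

lemma INF_product_risk:
  fixes M :: "(real \<times> 'b \<times> 'c) measure" and L :: "'c measure" and N :: "'b measure"
  assumes n: "1 \<le> n" and M: "prob_space M" and sM [measurable_cong]: "sets M = sets (borel \<Otimes>\<^sub>M N \<Otimes>\<^sub>M L)"
    and lower: "\<And>\<psi>. \<psi> \<in> borel_measurable L \<Longrightarrow> \<rho> \<le> (\<integral>\<^sup>+ x. ennreal ((fst x - \<psi> (snd (snd x)))\<^sup>2) \<partial>M)"
    and \<psi>0 [measurable]: "\<psi>0 \<in> borel_measurable L"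
    and opt: "(\<integral>\<^sup>+ x. ennreal ((fst x - \<psi>0 (snd (snd x)))\<^sup>2) \<partial>M) = \<rho>"
  shows "(INF \<phi> \<in> (\<Pi>\<^sub>M i\<in>{..<n}. L) \<rightarrow>\<^sub>M (\<Pi>\<^sub>M i\<in>{..<n}. (borel :: real measure)).
        \<integral>\<^sup>+ x. ennreal (1 / real n * (\<Sum>i<n. (fst (x i) - \<phi> (\<lambda>k\<in>{..<n}. snd (snd (x k))) i)\<^sup>2))
          \<partial>(\<Pi>\<^sub>M i\<in>{..<n}. M)) = \<rho>"
proof -
  let ?PM = "\<Pi>\<^sub>M i\<in>{..<n}. M"
  interpret M: prob_space M by fact
  interpret PP: product_prob_space "\<lambda>_::nat. M" ..
  have snd_m [measurable]: "(\<lambda>x. \<lambda>k\<in>{..<n}. snd (snd (x k))) \<in> ?PM \<rightarrow>\<^sub>M (\<Pi>\<^sub>M i\<in>{..<n}. L)"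
    by (rule measurable_restrict) measurable
  have avg: "(\<integral>\<^sup>+ x. ennreal (1 / real n * (\<Sum>i<n. (f i x)\<^sup>2)) \<partial>?PM) =
      (\<Sum>i<n. ennreal (1 / real n) * (\<integral>\<^sup>+ x. ennreal ((f i x)\<^sup>2) \<partial>?PM))"
    if [measurable]: "\<And>i. i < n \<Longrightarrow> f i \<in> borel_measurable ?PM" for f
  proof -
    have "(\<integral>\<^sup>+ x. ennreal (1 / real n * (\<Sum>i<n. (f i x)\<^sup>2)) \<partial>?PM) =
        (\<integral>\<^sup>+ x. (\<Sum>i<n. ennreal (1 / real n) * ennreal ((f i x)\<^sup>2)) \<partial>?PM)"
      by (intro nn_integral_cong) (simp add: sum_distrib_left ennreal_mult[symmetric] del: times_divide_eq_left)
    also have "\<dots> = (\<Sum>i<n. \<integral>\<^sup>+ x. ennreal (1 / real n) * ennreal ((f i x)\<^sup>2) \<partial>?PM)"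
      by (rule nn_integral_sum) auto
    also have "\<dots> = (\<Sum>i<n. ennreal (1 / real n) * (\<integral>\<^sup>+ x. ennreal ((f i x)\<^sup>2) \<partial>?PM))"
      by (intro sum.cong refl nn_integral_cmult) auto
    finally show ?thesis .
  qed
  \<comment> \<open>This is where \<open>1 \<le> n\<close> matters: for \<open>n = 0\<close> the sum
    is empty.\<close>
  have const: "(\<Sum>i<n. ennreal (1 / real n) * \<rho>) = \<rho>"
  proof -
    have "(\<Sum>i<n. ennreal (1 / real n) * \<rho>) = (of_nat n * ennreal (1 / real n)) * \<rho>" by (simp add: mult.assoc)
    also have "of_nat n * ennreal (1 / real n) = 1"
      using n by (simp add: ennreal_of_nat_eq_real_of_nat ennreal_mult[symmetric])
    finally show ?thesis by simp
  qed
  have coord: "(\<integral>\<^sup>+ x. f x \<partial>?PM) = (\<integral>\<^sup>+ x. \<integral>\<^sup>+ y. f (x(i := y)) \<partial>M \<partial>(\<Pi>\<^sub>M i\<in>{..<n} - {i}. M))"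
    if "i < n" "f \<in> borel_measurable ?PM" for i f
  proof -
    have "insert i ({..<n} - {i}) = {..<n}" using that by auto
    then show ?thesis using PP.product_nn_integral_insert[of "{..<n} - {i}" i f] that by simp
  qed
  show ?thesis
  proof (rule antisym)
    define \<phi> where "\<phi> z = (\<lambda>i\<in>{..<n}. \<psi>0 (z i))" for z
    have \<phi> [measurable]: "\<phi> \<in> (\<Pi>\<^sub>M i\<in>{..<n}. L) \<rightarrow>\<^sub>M (\<Pi>\<^sub>M i\<in>{..<n}. (borel :: real measure))"
      unfolding \<phi>_def by (rule measurable_restrict) measurable
    have "(\<integral>\<^sup>+ x. ennreal (1 / real n * (\<Sum>i<n. (fst (x i) - \<phi> (\<lambda>k\<in>{..<n}. snd (snd (x k))) i)\<^sup>2)) \<partial>?PM) =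
      (\<integral>\<^sup>+ x. ennreal (1 / real n * (\<Sum>i<n. (fst (x i) - \<psi>0 (snd (snd (x i))))\<^sup>2)) \<partial>?PM)"
      by (simp add: \<phi>_def)
    also have "\<dots> = (\<Sum>i<n. ennreal (1 / real n) * (\<integral>\<^sup>+ x. ennreal ((fst (x i) - \<psi>0 (snd (snd (x i))))\<^sup>2) \<partial>?PM))"
      by (rule avg) measurable
    also have "\<dots> = (\<Sum>i<n. ennreal (1 / real n) * \<rho>)"
    proof (intro sum.cong refl arg_cong2[where f=times])
      fix i assume "i \<in> {..<n}"
      then have i: "i < n" by simp
      interpret J: prob_space "\<Pi>\<^sub>M i\<in>{..<n} - {i}. M" by (intro prob_space_PiM M)
      show "(\<integral>\<^sup>+ x. ennreal ((fst (x i) - \<psi>0 (snd (snd (x i))))\<^sup>2) \<partial>?PM) = \<rho>"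
        using i by (subst coord[OF i]) (auto simp: opt J.emeasure_space_1)
    qed
    finally show "(INF \<phi> \<in> (\<Pi>\<^sub>M i\<in>{..<n}. L) \<rightarrow>\<^sub>M (\<Pi>\<^sub>M i\<in>{..<n}. (borel :: real measure)).
        \<integral>\<^sup>+ x. ennreal (1 / real n * (\<Sum>i<n. (fst (x i) - \<phi> (\<lambda>k\<in>{..<n}. snd (snd (x k))) i)\<^sup>2)) \<partial>?PM) \<le> \<rho>"
      unfolding const by (intro INF_lower2[OF \<phi>]) simp
  next
    show "\<rho> \<le> (INF \<phi> \<in> (\<Pi>\<^sub>M i\<in>{..<n}. L) \<rightarrow>\<^sub>M (\<Pi>\<^sub>M i\<in>{..<n}. (borel :: real measure)).
        \<integral>\<^sup>+ x. ennreal (1 / real n * (\<Sum>i<n. (fst (x i) - \<phi> (\<lambda>k\<in>{..<n}. snd (snd (x k))) i)\<^sup>2)) \<partial>?PM)"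
    proof (rule INF_greatest)
      fix \<phi> assume \<phi> [measurable]: "\<phi> \<in> (\<Pi>\<^sub>M i\<in>{..<n}. L) \<rightarrow>\<^sub>M (\<Pi>\<^sub>M i\<in>{..<n}. (borel :: real measure))"
      have \<phi>_i [measurable]: "(\<lambda>z. \<phi> z i) \<in> borel_measurable (\<Pi>\<^sub>M i\<in>{..<n}. L)" if "i < n" for i
        using that by (intro measurable_compose[OF \<phi>] measurable_component_singleton) simp
      have m: "(\<lambda>x. fst (x i) - \<phi> (\<lambda>k\<in>{..<n}. snd (snd (x k))) i) \<in> borel_measurable ?PM" if "i < n" for i
      proof -
        have "(\<lambda>x. x i) \<in> ?PM \<rightarrow>\<^sub>M M" "fst \<in> borel_measurable M"
          using that by (auto intro: measurable_component_singleton)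
        from measurable_compose[OF this] measurable_compose[OF snd_m \<phi>_i[OF that]]
        show ?thesis by (rule borel_measurable_diff)
      qed
      have "\<rho> = (\<Sum>i<n. ennreal (1 / real n) * \<rho>)" by (simp only: const)
      also have "\<dots> \<le> (\<Sum>i<n. ennreal (1 / real n) *
          (\<integral>\<^sup>+ x. ennreal ((fst (x i) - \<phi> (\<lambda>k\<in>{..<n}. snd (snd (x k))) i)\<^sup>2) \<partial>?PM))"
      proof (intro sum_mono mult_left_mono)
        fix i assume "i \<in> {..<n}"
        then have i: "i < n" by simp
        interpret J: prob_space "\<Pi>\<^sub>M i\<in>{..<n} - {i}. M" by (intro prob_space_PiM M)
        have "\<rho> = (\<integral>\<^sup>+ x. \<rho> \<partial>(\<Pi>\<^sub>M i\<in>{..<n} - {i}. M))" by (simp add: J.emeasure_space_1)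
        also have "\<dots> \<le> (\<integral>\<^sup>+ x. \<integral>\<^sup>+ y. ennreal ((fst ((x(i := y)) i) -
            \<phi> (\<lambda>k\<in>{..<n}. snd (snd ((x(i := y)) k))) i)\<^sup>2) \<partial>M \<partial>(\<Pi>\<^sub>M i\<in>{..<n} - {i}. M))"
        proof (rule nn_integral_mono)
          fix x assume x: "x \<in> space (\<Pi>\<^sub>M i\<in>{..<n} - {i}. M)"
          \<comment> \<open>The single-sample estimator obtained by freezing the outputs of all
            samples other than \<open>i\<close>.\<close>
          define \<psi> where "\<psi> z = \<phi> (\<lambda>k\<in>{..<n}. if k = i then z else snd (snd (x k))) i" for z
          have "(\<lambda>z. \<lambda>k\<in>{..<n}. if k = i then z else snd (snd (x k))) \<in> L \<rightarrow>\<^sub>M (\<Pi>\<^sub>M i\<in>{..<n}. L)"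
          proof (rule measurable_restrict)
            fix k assume k: "k \<in> {..<n}"
            show "(\<lambda>z. if k = i then z else snd (snd (x k))) \<in> L \<rightarrow>\<^sub>M L"
            proof (cases "k = i")
              case False
              with k x have "x k \<in> space M" by (auto simp: space_PiM)
              with False show ?thesis
                using sets_eq_imp_space_eq[OF sM] by (auto simp: space_pair_measure)
            qed simp
          qed
          then have "\<psi> \<in> borel_measurable L"
            unfolding \<psi>_def by (rule measurable_compose[OF _ \<phi>_i[OF i]])
          from lower[OF this]
          show "\<rho> \<le> (\<integral>\<^sup>+ y. ennreal ((fst ((x(i := y)) i) - \<phi> (\<lambda>k\<in>{..<n}. snd (snd ((x(i := y)) k))) i)\<^sup>2) \<partial>M)"
            by (simp add: \<psi>_def fun_upd_def if_distrib[of snd] cong: if_cong)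
        qed
        also have "\<dots> = (\<integral>\<^sup>+ x. ennreal ((fst (x i) - \<phi> (\<lambda>k\<in>{..<n}. snd (snd (x k))) i)\<^sup>2) \<partial>?PM)"
          using m[OF i] by (subst coord[OF i]) auto
        finally show "\<rho> \<le> (\<integral>\<^sup>+ x. ennreal ((fst (x i) - \<phi> (\<lambda>k\<in>{..<n}. snd (snd (x k))) i)\<^sup>2) \<partial>?PM)" .
      qed simp
      also have "\<dots> = (\<integral>\<^sup>+ x. ennreal (1 / real n *
          (\<Sum>i<n. (fst (x i) - \<phi> (\<lambda>k\<in>{..<n}. snd (snd (x k))) i)\<^sup>2)) \<partial>?PM)"
        by (rule avg[symmetric]) (rule m)
      finally show "\<rho> \<le> \<dots>" .
    qed
  qed
qed

section \<open>Reduction of the risk to the error along \<open>a\<close>\<close>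

context observation
begin

context
  fixes K :: "'m kernel" assumes K: "K \<in> kernels"
begin

lemma measurable_source_channel_kernel:
  "(\<lambda>(t, y). K y \<bind> (\<lambda>z. return (borel \<Otimes>\<^sub>M borel \<Otimes>\<^sub>M borel) (t, y, z)))
    \<in> (borel :: real measure) \<Otimes>\<^sub>M borel \<rightarrow>\<^sub>M prob_algebra (borel \<Otimes>\<^sub>M borel \<Otimes>\<^sub>M borel)"
proof -
  note [measurable] = kernels_measurable[OF K]
  show ?thesis by measurable
qed

lemma source_obs_law_in_prob_algebra: "source_obs_law a \<in> space (prob_algebra (borel \<Otimes>\<^sub>M borel))"
  using prob_space_source_obs_law by (simp add: space_prob_algebra)

lemma prob_space_source_channel_law: "prob_space (source_channel_law a K)"
  unfolding source_channel_law_def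
  by (rule prob_space_bind'[OF source_obs_law_in_prob_algebra measurable_source_channel_kernel])

lemma sets_source_channel_law: "sets (source_channel_law a K) = sets (borel \<Otimes>\<^sub>M borel \<Otimes>\<^sub>M borel)"
  unfolding source_channel_law_def
  by (rule sets_bind'[OF source_obs_law_in_prob_algebra measurable_source_channel_kernel])

lemma nn_integral_source_channel_law:
  assumes [measurable]: "F \<in> borel_measurable (borel \<Otimes>\<^sub>M borel \<Otimes>\<^sub>M borel)"
  shows "(\<integral>\<^sup>+ x. F x \<partial>source_channel_law a K) =
    (\<integral>\<^sup>+ x. \<integral>\<^sup>+ z. F (fst x, snd x, z) \<partial>K (snd x) \<partial>source_obs_law a)"
proof -
  note [measurable] = kernels_measurable[OF K] measurable_source_channel_kernel
  have "(\<integral>\<^sup>+ x. F x \<partial>source_channel_law a K) =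
      (\<integral>\<^sup>+ x. \<integral>\<^sup>+ w. F w \<partial>(case x of (t, y) \<Rightarrow> K y \<bind> (\<lambda>z. return (borel \<Otimes>\<^sub>M borel \<Otimes>\<^sub>M borel) (t, y, z))) \<partial>source_obs_law a)"
    unfolding source_channel_law_def
    by (rule nn_integral_bind[where B="borel \<Otimes>\<^sub>M borel \<Otimes>\<^sub>M borel"])
       (auto intro!: measurable_prob_algebraD simp: measurable_cong_sets[OF sets_source_obs_law refl])
  also have "\<dots> = (\<integral>\<^sup>+ x. \<integral>\<^sup>+ z. F (fst x, snd x, z) \<partial>K (snd x) \<partial>source_obs_law a)"
  proof (rule nn_integral_cong)
    fix x :: "real \<times> (real ^ 'm)"
    have [simp, measurable_cong]: "sets (K (snd x)) = sets borel" using kernels_prob[OF K] by simp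
    have "(\<integral>\<^sup>+ w. F w \<partial>(case x of (t, y) \<Rightarrow> K y \<bind> (\<lambda>z. return (borel \<Otimes>\<^sub>M borel \<Otimes>\<^sub>M borel) (t, y, z)))) =
        (\<integral>\<^sup>+ w. F w \<partial>(K (snd x) \<bind> (\<lambda>z. return (borel \<Otimes>\<^sub>M borel \<Otimes>\<^sub>M borel) (fst x, snd x, z))))"
      by (simp add: case_prod_unfold)
    also have "\<dots> = (\<integral>\<^sup>+ z. \<integral>\<^sup>+ w. F w \<partial>return (borel \<Otimes>\<^sub>M borel \<Otimes>\<^sub>M borel) (fst x, snd x, z) \<partial>K (snd x))"
      by (rule nn_integral_bind[where B="borel \<Otimes>\<^sub>M borel \<Otimes>\<^sub>M borel"]) (auto intro!: measurable_prob_algebraD)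
    also have "\<dots> = (\<integral>\<^sup>+ z. F (fst x, snd x, z) \<partial>K (snd x))"
      by (intro nn_integral_cong nn_integral_return) (auto simp: space_pair_measure)
    finally show "(\<integral>\<^sup>+ w. F w \<partial>(case x of (t, y) \<Rightarrow> K y \<bind> (\<lambda>z. return (borel \<Otimes>\<^sub>M borel \<Otimes>\<^sub>M borel) (t, y, z)))) = \<dots>" .
  qed
  finally show ?thesis .
qed

text \<open>Given \<open>y\<close>, the posterior noise and the output are independent by the Markov
  chain. For fixed \<open>z\<close> the noise has mean 0, so the cross term vanishes and only its
  variance \<open>1 / r^2\<close> is added. In \<open>ennreal\<close> this also covers infinite
  risks.\<close>

lemma risk_split:
  assumes [measurable]: "\<psi> \<in> borel_measurable borel"
  shows "(\<integral>\<^sup>+ x. ennreal ((fst x - \<psi> (snd (snd x)))\<^sup>2) \<partial>source_channel_law a K) =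
    ennreal (1 / r\<^sup>2) + (\<integral>\<^sup>+ (y, z). ennreal ((s / r\<^sup>2 * T y $ k - \<psi> z)\<^sup>2) \<partial>channel_law (gauss_law T sd) K)"
proof -
  note [measurable] = kernels_measurable[OF K] borel_measurable_T[OF T]
  interpret N: prob_space std_normal by (rule prob_space_std_normal)
  have P: "prob_space (gauss_law T sd)" by (rule prob_space_gauss_law[OF T])
  interpret Q: prob_space "channel_law (gauss_law T sd) K"
    by (rule prob_space_channel_law[OF P _ K]) simp
  have "(\<integral>\<^sup>+ x. ennreal ((fst x - \<psi> (snd (snd x)))\<^sup>2) \<partial>source_channel_law a K) =
      (\<integral>\<^sup>+ x. \<integral>\<^sup>+ z. ennreal ((fst x - \<psi> z)\<^sup>2) \<partial>K (snd x) \<partial>source_obs_law a)"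
    by (subst nn_integral_source_channel_law) auto
  also have "\<dots> = (\<integral>\<^sup>+ y. \<integral>\<^sup>+ n. \<integral>\<^sup>+ z. ennreal ((s / r\<^sup>2 * T y $ k + 1 / r * n - \<psi> z)\<^sup>2) \<partial>K y \<partial>std_normal \<partial>gauss_law T sd)"
    by (subst nn_integral_source_obs_law) (auto intro!: nn_integral_measurable_subprob_algebra2[where N=borel] measurable_prob_algebraD)
  also have "\<dots> = (\<integral>\<^sup>+ y. \<integral>\<^sup>+ z. ennreal (1 / r\<^sup>2 + (s / r\<^sup>2 * T y $ k - \<psi> z)\<^sup>2) \<partial>K y \<partial>gauss_law T sd)"
  proof (rule nn_integral_cong)
    fix y
    have [measurable_cong]: "sets (K y) = sets borel" using kernels_prob[OF K] by simp
    interpret pair_prob_space std_normal "K y"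
      using kernels_prob[OF K, of y]
      by (intro pair_prob_space.intro pair_sigma_finite.intro prob_space_imp_sigma_finite prob_space_std_normal)
    have "(\<integral>\<^sup>+ n. \<integral>\<^sup>+ z. ennreal ((s / r\<^sup>2 * T y $ k + 1 / r * n - \<psi> z)\<^sup>2) \<partial>K y \<partial>std_normal) =
        (\<integral>\<^sup>+ z. \<integral>\<^sup>+ n. ennreal ((s / r\<^sup>2 * T y $ k + 1 / r * n - \<psi> z)\<^sup>2) \<partial>std_normal \<partial>K y)"
      by (rule Fubini'[symmetric]) measurable
    also have "\<dots> = (\<integral>\<^sup>+ z. ennreal (1 / r\<^sup>2 + (s / r\<^sup>2 * T y $ k - \<psi> z)\<^sup>2) \<partial>K y)"
    proof (rule nn_integral_cong)
      fix z
      have "s / r\<^sup>2 * T y $ k + 1 / r * n - \<psi> z = 1 / r * n + (s / r\<^sup>2 * T y $ k - \<psi> z)" for n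
        by simp
      then show "(\<integral>\<^sup>+ n. ennreal ((s / r\<^sup>2 * T y $ k + 1 / r * n - \<psi> z)\<^sup>2) \<partial>std_normal) =
          ennreal (1 / r\<^sup>2 + (s / r\<^sup>2 * T y $ k - \<psi> z)\<^sup>2)"
        by (simp only: nn_integral_std_normal_affine_square power_divide power_one)
    qed
    finally show "(\<integral>\<^sup>+ n. \<integral>\<^sup>+ z. ennreal ((s / r\<^sup>2 * T y $ k + 1 / r * n - \<psi> z)\<^sup>2) \<partial>K y \<partial>std_normal) =
        (\<integral>\<^sup>+ z. ennreal (1 / r\<^sup>2 + (s / r\<^sup>2 * T y $ k - \<psi> z)\<^sup>2) \<partial>K y)" .
  qed
  also have "\<dots> = (\<integral>\<^sup>+ x. ennreal (1 / r\<^sup>2 + (s / r\<^sup>2 * T (fst x) $ k - \<psi> (snd x))\<^sup>2) \<partial>channel_law (gauss_law T sd) K)"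
    by (subst nn_integral_channel_law[OF P _ K]) auto
  also have "\<dots> = (\<integral>\<^sup>+ x. ennreal (1 / r\<^sup>2) + ennreal ((s / r\<^sup>2 * T (fst x) $ k - \<psi> (snd x))\<^sup>2) \<partial>channel_law (gauss_law T sd) K)"
    by (intro nn_integral_cong) (simp add: ennreal_plus)
  also have "\<dots> = ennreal (1 / r\<^sup>2) + (\<integral>\<^sup>+ x. ennreal ((s / r\<^sup>2 * T (fst x) $ k - \<psi> (snd x))\<^sup>2) \<partial>channel_law (gauss_law T sd) K)"
  proof -
    have [measurable_cong]: "sets (channel_law (gauss_law T sd) K) = sets (borel \<Otimes>\<^sub>M borel)"
      by (rule sets_channel_law[OF P _ K]) simp
    show ?thesis by (subst nn_integral_add) (auto simp: Q.emeasure_space_1)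
  qed
  finally show ?thesis by (simp add: case_prod_unfold)
qed

end

text \<open>Estimating the posterior mean is estimating \<open>T y $ k\<close> up to the factor
  \<open>s / r^2\<close>, so the coordinate error \<delta> enters with the square of that
  factor.\<close>

lemma bayes_risk_rd_achieving:
  assumes n: "1 \<le> n" and \<delta>: "0 < \<delta>" "\<delta> \<le> r\<^sup>2"
    and level: "(\<Sum>i\<in>UNIV. ln (max \<delta> ((sd i)\<^sup>2) / \<delta>) / 2) = R * ln 2"
    and K: "rd_achieving (obs_law a) R K"
  shows "bayes_risk n a K = ennreal (1 / r\<^sup>2 + (s / r\<^sup>2)\<^sup>2 * \<delta>)"
proof -
  interpret wl: water_level T "\<lambda>i. (sd i)\<^sup>2" \<delta> R
    using T \<delta> level by unfold_locales (auto simp: zero_less_power sd_pos simp del: zero_less_power_eq_numeral zero_less_power2)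
  have sd': "(\<lambda>i. sqrt ((sd i)\<^sup>2)) = sd" by (simp add: abs_of_pos[OF sd_pos])
  have src: "wl.src = gauss_law T sd" unfolding wl.src_def sd' by (rule refl)
  have K': "K \<in> kernels" "channel_rate (gauss_law T sd) K \<le> ereal R"
    "channel_distortion (gauss_law T sd) K = ennreal (\<Sum>i\<in>UNIV. min \<delta> ((sd i)\<^sup>2))"
    using K unfolding obs_law_eq src[symmetric] wl.rd_achieving_iff by auto
  interpret wf: waterfilling T "\<lambda>i. (sd i)\<^sup>2" K \<delta> R
    using T K' \<delta> level by unfold_locales (auto simp: abs_of_pos[OF sd_pos] zero_less_power sd_pos simp del: zero_less_power_eq_numeral zero_less_power2)
  have k: "\<delta> \<le> (sd k)\<^sup>2" using \<delta> by (simp add: sd_def)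
  note bound = wf.coord_error_lower_bound[OF _ k, unfolded sd', OF K'(3)]
  note attained = wf.coord_error_attained[OF _ k, unfolded sd', OF K'(3)]
  let ?c = "s / r\<^sup>2"
  let ?Q = "channel_law (gauss_law T sd) K"
  have [measurable_cong]: "sets ?Q = sets (borel \<Otimes>\<^sub>M borel)" using wf.sets_Q by (simp add: abs_of_pos[OF sd_pos])
  have scale: "(\<integral>\<^sup>+ (y, z). ennreal ((?c * T y $ k - ?c * f z)\<^sup>2) \<partial>?Q) =
      ennreal (?c\<^sup>2) * (\<integral>\<^sup>+ (y, z). ennreal ((T y $ k - f z)\<^sup>2) \<partial>?Q)"
    if [measurable]: "f \<in> borel_measurable borel" for f
  proof -
    have "(?c * T y $ k - ?c * f z)\<^sup>2 = ?c\<^sup>2 * (T y $ k - f z)\<^sup>2" for y z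
      by (simp only: right_diff_distrib[symmetric] power_mult_distrib)
    then have "(\<integral>\<^sup>+ (y, z). ennreal ((?c * T y $ k - ?c * f z)\<^sup>2) \<partial>?Q) =
        (\<integral>\<^sup>+ x. ennreal (?c\<^sup>2) * (case x of (y, z) \<Rightarrow> ennreal ((T y $ k - f z)\<^sup>2)) \<partial>?Q)"
      by (intro nn_integral_cong) (auto simp: ennreal_mult)
    also have "\<dots> = ennreal (?c\<^sup>2) * (\<integral>\<^sup>+ (y, z). ennreal ((T y $ k - f z)\<^sup>2) \<partial>?Q)"
      by (rule nn_integral_cmult) measurable
    finally show ?thesis .
  qed
  have \<rho>: "ennreal (1 / r\<^sup>2 + ?c\<^sup>2 * \<delta>) = ennreal (1 / r\<^sup>2) + ennreal (?c\<^sup>2) * ennreal \<delta>"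
    using \<delta> by (simp add: ennreal_plus ennreal_mult)
  show ?thesis
    unfolding bayes_risk_def
  proof (rule INF_product_risk[OF n prob_space_source_channel_law[OF K'(1)] sets_source_channel_law[OF K'(1)]])
    fix \<psi> :: "real ^ 'm \<Rightarrow> real" assume \<psi> [measurable]: "\<psi> \<in> borel_measurable borel"
    have "ennreal (?c\<^sup>2) * ennreal \<delta> \<le> (\<integral>\<^sup>+ (y, z). ennreal ((?c * T y $ k - \<psi> z)\<^sup>2) \<partial>?Q)"
    \<comment> \<open>For \<open>s = 0\<close> the left side is 0. Otherwise
      \<open>\<psi> z / ?c\<close> is a competing estimator of \<open>T y $ k\<close>.\<close>
    proof (cases "s = 0")
      case False
      then have c: "?c \<noteq> 0" using r_pos by simp
      have "ennreal (?c\<^sup>2) * ennreal \<delta> \<le> ennreal (?c\<^sup>2) * (\<integral>\<^sup>+ (y, z). ennreal ((T y $ k - \<psi> z / ?c)\<^sup>2) \<partial>?Q)"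
        by (intro mult_left_mono bound) auto
      also have "\<dots> = (\<integral>\<^sup>+ (y, z). ennreal ((?c * T y $ k - ?c * (\<psi> z / ?c))\<^sup>2) \<partial>?Q)"
        by (rule scale[symmetric]) measurable
      also have "\<dots> = (\<integral>\<^sup>+ (y, z). ennreal ((?c * T y $ k - \<psi> z)\<^sup>2) \<partial>?Q)"
        by (simp only: nonzero_mult_div_cancel_left[OF c] times_divide_eq_right)
      finally show ?thesis .
    qed simp
    then show "ennreal (1 / r\<^sup>2 + ?c\<^sup>2 * \<delta>) \<le> (\<integral>\<^sup>+ x. ennreal ((fst x - \<psi> (snd (snd x)))\<^sup>2) \<partial>source_channel_law a K)"
      unfolding risk_split[OF K'(1) \<psi>] \<rho> by (rule add_left_mono)
  next
    \<comment> \<open>The rescaled output coordinate along \<open>a\<close> attains the lower bound,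
      so no conditional expectation has to be computed.\<close>
    show m: "(\<lambda>z. ?c * T z $ k) \<in> borel_measurable borel" by measurable
    show "(\<integral>\<^sup>+ x. ennreal ((fst x - ?c * T (snd (snd x)) $ k)\<^sup>2) \<partial>source_channel_law a K) = ennreal (1 / r\<^sup>2 + ?c\<^sup>2 * \<delta>)"
      unfolding risk_split[OF K'(1) m] \<rho> using scale[of "\<lambda>z. T z $ k"] attained by simp
  qed
qed

lemma ex_rd_achieving:
  assumes "0 < \<delta>" and level: "(\<Sum>i\<in>UNIV. ln (max \<delta> ((sd i)\<^sup>2) / \<delta>) / 2) = R * ln 2"
  shows "\<exists>K. rd_achieving (obs_law a) R K"
proof -
  interpret wl: water_level T "\<lambda>i. (sd i)\<^sup>2" \<delta> R
    using T assms by unfold_locales (auto simp: zero_less_power sd_pos simp del: zero_less_power_eq_numeral zero_less_power2)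
  have "wl.src = obs_law a"
    by (simp add: wl.src_def obs_law_eq abs_of_pos[OF sd_pos])
  then show ?thesis using wl.rd_achieving_opt_kernel by auto
qed

end

section \<open>Choice of the rotation and of the water level\<close>

theorem proposition7:
  fixes a :: "real ^ 'm::finite" and n :: nat and R \<gamma> R\<^sub>\<gamma> :: real and \<eta> :: "real \<Rightarrow> real"
  assumes "n \<ge> 1" and "R \<ge> 0"
    and "\<gamma> = (\<Sum>j\<in>UNIV. (a $ j)\<^sup>2)"
    and "R\<^sub>\<gamma> = 1 / 2 * log 2 (1 + \<gamma>)"
    and "\<eta> = (\<lambda>r. if r \<le> R\<^sub>\<gamma> then 2 powr (- 2 * r)
                 else 2 powr (- (2 / real CARD('m)) * (r - R\<^sub>\<gamma>) - 2 * R\<^sub>\<gamma>))"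
  shows "(\<exists>K. rd_achieving (obs_law a) R K) \<and>
         (\<forall>K. rd_achieving (obs_law a) R K \<longrightarrow>
           bayes_risk n a K = ennreal (1 / (\<gamma> + 1) + \<gamma> / (\<gamma> + 1) * \<eta> R))"
proof -
  obtain k :: 'm where True by simp
  define s where "s = norm a"
  have "\<exists>T. orthogonal_transformation T \<and> T a = s *\<^sub>R axis k (1::real)"
  proof -
    \<comment> \<open>For \<open>a = 0\<close> any unit vector serves, because then
      \<open>s = 0\<close>.\<close>
    define u where "u = (if a = 0 then axis k 1 else a /\<^sub>R norm a)"
    have "norm u = 1" "a = s *\<^sub>R u" by (auto simp: u_def s_def norm_axis_1)
    moreover obtain T where T: "orthogonal_transformation T" "T u = axis k (1::real)"
      using orthogonal_transformation_exists_1[of u "axis k 1"] \<open>norm u = 1\<close> by (auto simp: norm_axis_1)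
    ultimately show ?thesis
      using orthogonal_transformation_linear[OF T(1)] by (metis linear_scale)
  qed
  then obtain T where T: "orthogonal_transformation T" "T a = s *\<^sub>R axis k (1::real)" by blast
  interpret observation a T k s using T by unfold_locales
  have \<gamma>: "\<gamma> = s\<^sup>2" using assms(3) by (simp add: s_def norm_vec_def L2_set_def sum_nonneg)
  have \<gamma>0: "0 \<le> \<gamma>" and r2: "r\<^sup>2 = 1 + \<gamma>" by (simp_all add: \<gamma> r_sq)
  have R\<gamma>: "2 powr (2 * R\<^sub>\<gamma>) = 1 + \<gamma>" proof -
    have "2 * R\<^sub>\<gamma> = log 2 (1 + \<gamma>)" using assms(4) by simp
    then show ?thesis using \<gamma>0 by simp
  qed
  have R\<gamma>0: "0 \<le> R\<^sub>\<gamma>" using \<gamma>0 by (simp add: assms(4))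
  define m where "m = real CARD('m)"
  have m: "1 \<le> m" by (simp add: m_def Suc_le_eq)
  \<comment> \<open>Solved from the claimed formula, in which the risk beyond
    \<open>1 / (1 + \<gamma>)\<close> must be \<open>\<gamma> / (1 + \<gamma>)^2 * \<delta>\<close>;
    that it is the water level for rate \<open>R\<close> is checked below.\<close>
  define \<delta> where "\<delta> = (1 + \<gamma>) * \<eta> R"
  have \<delta>0: "0 < \<delta>" using \<gamma>0 by (simp add: \<delta>_def assms(5))
  have \<delta>1: "\<delta> = (if R \<le> R\<^sub>\<gamma> then 2 powr (2 * (R\<^sub>\<gamma> - R)) else 2 powr (- (2 / m) * (R - R\<^sub>\<gamma>)))"
    unfolding \<delta>_def assms(5) R\<gamma>[symmetric] by (simp add: powr_add[symmetric] m_def algebra_simps)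
  \<comment> \<open>The direction of \<open>a\<close> never falls below the level, because
    \<open>R \<ge> 0\<close>. At rate 0 the two can coincide.\<close>
  have \<delta>r: "\<delta> \<le> r\<^sup>2"
  proof -
    have "\<eta> R \<le> 1"
    proof -
      have "0 \<le> 2 / real CARD('m) * (R - R\<^sub>\<gamma>)" if "\<not> R \<le> R\<^sub>\<gamma>"
        using that by (intro mult_nonneg_nonneg) auto
      then have "(if R \<le> R\<^sub>\<gamma> then - 2 * R else - (2 / real CARD('m)) * (R - R\<^sub>\<gamma>) - 2 * R\<^sub>\<gamma>) \<le> 0"
        using assms(2) R\<gamma>0 by (simp only: mult_minus_left split: if_split) linarith
      from powr_mono[OF this, of 2] show ?thesis by (simp add: assms(5) split: if_splits)
    qed
    then show ?thesis using \<gamma>0 by (simp add: \<delta>_def r2 mult_left_le)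
  qed
  have sum_sd: "(\<Sum>i\<in>UNIV. ln (max \<delta> ((sd i)\<^sup>2) / \<delta>) / 2) = ln ((1 + \<gamma>) / \<delta>) / 2 + (m - 1) * (ln (max \<delta> 1 / \<delta>) / 2)"
  proof -
    have "(\<Sum>i\<in>UNIV. ln (max \<delta> ((sd i)\<^sup>2) / \<delta>) / 2) =
        ln (max \<delta> ((sd k)\<^sup>2) / \<delta>) / 2 + (\<Sum>i\<in>UNIV - {k}. ln (max \<delta> ((sd i)\<^sup>2) / \<delta>) / 2)"
      by (rule sum.remove) auto
    also have "(\<Sum>i\<in>UNIV - {k}. ln (max \<delta> ((sd i)\<^sup>2) / \<delta>) / 2) = (\<Sum>i\<in>UNIV - {k}. ln (max \<delta> 1 / \<delta>) / 2)"
      by (intro sum.cong) (auto simp: sd_def)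
    also have "\<dots> = (m - 1) * (ln (max \<delta> 1 / \<delta>) / 2)"
      by (simp add: m_def card_Diff_singleton of_nat_diff Suc_le_eq)
    finally show ?thesis using \<delta>r by (simp add: sd_def r2 max_def)
  qed
  have ln_r: "ln (1 + \<gamma>) = 2 * R\<^sub>\<gamma> * ln 2" unfolding R\<gamma>[symmetric] by (simp add: ln_powr)
  have level: "(\<Sum>i\<in>UNIV. ln (max \<delta> ((sd i)\<^sup>2) / \<delta>) / 2) = R * ln 2"
  proof (cases "R \<le> R\<^sub>\<gamma>")
    \<comment> \<open>The level is at least 1, the variance of the pure noise directions, so these
      get no rate.\<close>
    case True
    then have "1 \<le> \<delta>" by (simp add: \<delta>1 ge_one_powr_ge_zero)
    moreover have "ln \<delta> = 2 * (R\<^sub>\<gamma> - R) * ln 2" using True by (simp add: \<delta>1 ln_powr)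
    ultimately show ?thesis
      unfolding sum_sd using \<gamma>0 \<delta>0 by (simp add: ln_div ln_r algebra_simps max_def)
  next
    \<comment> \<open>The level is at most 1: each of the \<open>m\<close> coordinates gets
      \<open>- ln \<delta> / 2\<close> nats, and the direction of \<open>a\<close> gets
      \<open>R\<^sub>\<gamma>\<close> bits on top.\<close>
    case False
    then have "- (2 / m) * (R - R\<^sub>\<gamma>) \<le> 0" using m by (simp add: mult_nonpos_nonneg)
    then have "\<delta> \<le> 1" using False powr_mono[of "- (2 / m) * (R - R\<^sub>\<gamma>)" 0 2] by (simp add: \<delta>1)
    moreover have ln\<delta>: "ln \<delta> = - (2 / m) * (R - R\<^sub>\<gamma>) * ln 2" using False by (simp add: \<delta>1 ln_powr)
    ultimately have "(\<Sum>i\<in>UNIV. ln (max \<delta> ((sd i)\<^sup>2) / \<delta>) / 2) = R\<^sub>\<gamma> * ln 2 - m * ln \<delta> / 2"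
      unfolding sum_sd using \<gamma>0 \<delta>0 by (simp add: ln_div ln_r max_absorb2) (simp add: field_simps)
    also have "\<dots> = R * ln 2" using m unfolding ln\<delta> by (simp add: field_simps)
    finally show ?thesis .
  qed
  have "1 / r\<^sup>2 + (s / r\<^sup>2)\<^sup>2 * \<delta> = 1 / (\<gamma> + 1) + \<gamma> / (\<gamma> + 1) * \<eta> R"
  proof -
    have "(s / r\<^sup>2)\<^sup>2 = \<gamma> / (1 + \<gamma>)\<^sup>2" by (simp only: power_divide r2 \<gamma>)
    then have "(s / r\<^sup>2)\<^sup>2 * \<delta> = \<gamma> / (1 + \<gamma>) * \<eta> R"
      using \<gamma>0 by (simp add: \<delta>_def power2_eq_square)
    then show ?thesis by (simp add: r2 add.commute)
  qed
  then show ?thesis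
    using ex_rd_achieving[OF \<delta>0 level] bayes_risk_rd_achieving[OF assms(1) \<delta>0 \<delta>r level] by simp
qed

end
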